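(* Let $G$ be the additive group $\mathbb{R}$ or the circle group $S^1=\mathbb{R}/2\pi\mathbb{Z}$ (written additively, identity $0$), with Borel $\sigma$-algebra $\mathcal{B}(G)$. Let $U_{\mathcal{S}}$, $U_{\mathcal{R}}$ be strongly continuous unitary representations of $G$ on separable Hilbert spaces $\mathcal{H}_{\mathcal{S}}$, $\mathcal{H}_{\mathcal{R}}$, and let $\mathsf{F}:\mathcal{B}(G)\to\mathcal{L}(\mathcal{H}_{\mathcal{R}})$ be a POM that is covariant, $U_{\mathcal{R}}(g)\mathsf{F}(X)U_{\mathcal{R}}(g)^*=\mathsf{F}(X+g)$ for all $g\in G$, $X\in\mathcal{B}(G)$, and that has the norm-1 property: for every $X\in\mathcal{B}(G)$ with $\mathsf{F}(X)\neq0$ there is a sequence of unit vectors $(\phi_n)\subset\mathcal{H}_{\mathcal{R}}$ with $\lim_n\langle\phi_n,\mathsf{F}(X)\phi_n\rangle=1$. Define $$\yen(A)=\int_G U_{\mathcal{S}}(g)AU_{\mathcal{S}}(g)^*\otimes\mathsf{F}(dg),\qquad A\in\mathcal{L}(\mathcal{H}_{\mathcal{S}}),$$ and for a unit vector $\phi\in\mathcal{H}_{\mathcal{R}}$ let $\Gamma_\phi:\mathcal{L}(\mathcal{H}_{\mathcal{S}}\otimes\mathcal{H}_{\mathcal{R}})\to\mathcal{L}(\mathcal{H}_{\mathcal{S}})$ be the map determined by $\mathrm{tr}[\rho\,\Gamma_\phi(\Lambda)]=\mathrm{tr}[(\rho\otimes|\phi\rangle\langle\phi|)\Lambda]$ for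 all density operators $\rho$ on $\mathcal{H}_{\mathcal{S}}$. Then there exists a sequence of unit vectors $(\phi_n)\subset\mathcal{H}_{\mathcal{R}}$ such that for every $A\in\mathcal{L}(\mathcal{H}_{\mathcal{S}})$, $$\lim_{n\to\infty}(\Gamma_{\phi_n}\circ\yen)(A)=A$$ in the weak sense, i.e. $\lim_n\mathrm{tr}[\rho\,\Gamma_{\phi_n}(\yen(A))]=\mathrm{tr}[\rho A]$ for every density operator $\rho$ on $\mathcal{H}_{\mathcal{S}}$.
   Context: A POM is a normalised, countably additive (weakly) map from a $\sigma$-algebra into positive bounded operators. The integral defining $\yen(A)$ is the integral of the bounded strongly continuous function $g\mapsto U_{\mathcal{S}}(g)AU_{\mathcal{S}}(g)^*$ against the operator measure $\mathsf{F}$, understood weakly via the scalar measures $X\mapsto\langle\eta,\mathsf{F}(X)\eta'\rangle$ and extended by linearity and continuity. *)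

theory Defs
  imports "HOL-Analysis.Analysis"
begin

class chilbert = banach +
  fixes cscale :: "complex \<Rightarrow> 'a \<Rightarrow> 'a"
    and cinner :: "'a \<Rightarrow> 'a \<Rightarrow> complex"
  assumes cscale_add_right: "cscale c (x + y) = cscale c x + cscale c y"
    and cscale_add_left: "cscale (a + b) x = cscale a x + cscale b x"
    and cscale_cscale: "cscale a (cscale b x) = cscale (a * b) x"
    and cscale_one: "cscale 1 x = x"
    and scaleR_cscale: "scaleR r x = cscale (complex_of_real r) x"
    and cinner_conj: "cinner x y = cnj (cinner y x)"
    and cinner_add_right: "cinner x (y + z) = cinner x y + cinner x z"
    and cinner_cscale_right: "cinner x (cscale c y) = c * cinner x y"
    and norm_cinner: "norm x = sqrt (Re (cinner x x))"

definition separable :: "'a::metric_space set \<Rightarrow> bool" where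
  "separable S \<longleftrightarrow> (\<exists>D. countable D \<and> D \<subseteq> S \<and> S \<subseteq> closure D)"

definition cspan :: "'a::chilbert set \<Rightarrow> 'a set" where
  "cspan S = {x. \<exists>T c. finite T \<and> T \<subseteq> S \<and> x = (\<Sum>s\<in>T. cscale (c s) s)}"

definition clinear :: "('a::chilbert \<Rightarrow> 'b::chilbert) \<Rightarrow> bool" where
  "clinear f \<longleftrightarrow> (\<forall>x y. f (x + y) = f x + f y) \<and> (\<forall>c x. f (cscale c x) = cscale c (f x))"

definition bop :: "('a::chilbert \<Rightarrow> 'b::chilbert) \<Rightarrow> bool" where
  "bop f \<longleftrightarrow> clinear f \<and> (\<exists>K. \<forall>x. norm (f x) \<le> K * norm x)"

definition adj :: "('a::chilbert \<Rightarrow> 'b::chilbert) \<Rightarrow> ('b \<Rightarrow> 'a)" where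
  "adj A = (THE B. \<forall>x y. cinner x (A y) = cinner (B x) y)"

definition unitary :: "('a::chilbert \<Rightarrow> 'a) \<Rightarrow> bool" where
  "unitary U \<longleftrightarrow> bop U \<and> bij U \<and> (\<forall>x y. cinner (U x) (U y) = cinner x y)"

definition positive_op :: "('a::chilbert \<Rightarrow> 'a) \<Rightarrow> bool" where
  "positive_op A \<longleftrightarrow> bop A \<and> (\<forall>x. Im (cinner x (A x)) = 0 \<and> 0 \<le> Re (cinner x (A x)))"

definition onb :: "'a::chilbert set \<Rightarrow> bool" where
  "onb B \<longleftrightarrow> (\<forall>e\<in>B. norm e = 1) \<and> (\<forall>e\<in>B. \<forall>f\<in>B. e \<noteq> f \<longrightarrow> cinner e f = 0)
     \<and> closure (cspan B) = UNIV"

definition trace :: "('a::chilbert \<Rightarrow> 'a) \<Rightarrow> complex" where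
  "trace T = infsum (\<lambda>e. cinner e (T e)) (SOME B. onb B)"

definition density :: "('a::chilbert \<Rightarrow> 'a) \<Rightarrow> bool" where
  "density \<rho> \<longleftrightarrow> positive_op \<rho> \<and> (\<exists>B. onb B \<and> ((\<lambda>e. Re (cinner e (\<rho> e))) has_sum 1) B)"

definition ketbra :: "'a::chilbert \<Rightarrow> 'a \<Rightarrow> 'a" where
  "ketbra \<phi> = (\<lambda>x. cscale (cinner \<phi> x) \<phi>)"

definition is_tensor :: "('a::chilbert \<Rightarrow> 'b::chilbert \<Rightarrow> 'c::chilbert) \<Rightarrow> bool" where
  "is_tensor t \<longleftrightarrow>
     (\<forall>a a' b. t (a + a') b = t a b + t a' b) \<and>
     (\<forall>a b b'. t a (b + b') = t a b + t a b') \<and>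
     (\<forall>c a b. t (cscale c a) b = cscale c (t a b)) \<and>
     (\<forall>c a b. t a (cscale c b) = cscale c (t a b)) \<and>
     (\<forall>a a' b b'. cinner (t a b) (t a' b') = cinner a a' * cinner b b') \<and>
     closure (cspan (range (case_prod t))) = UNIV"

definition optens :: "('a::chilbert \<Rightarrow> 'b::chilbert \<Rightarrow> 'c::chilbert) \<Rightarrow> ('a \<Rightarrow> 'a) \<Rightarrow> ('b \<Rightarrow> 'b) \<Rightarrow> ('c \<Rightarrow> 'c)" where
  "optens t S T = (THE W. bop W \<and> (\<forall>a b. W (t a b) = t (S a) (T b)))"

datatype grp = RealLine | Circle

fun gcarrier :: "grp \<Rightarrow> real set" where
  "gcarrier RealLine = UNIV"
| "gcarrier Circle = {0..<2*pi}"

fun gadd :: "grp \<Rightarrow> real \<Rightarrow> real \<Rightarrow> real" where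
  "gadd RealLine x y = x + y"
| "gadd Circle x y = (x + y) - 2*pi * of_int \<lfloor>(x + y) / (2*pi)\<rfloor>"

definition gsets :: "grp \<Rightarrow> real set set" where
  "gsets G = sets (restrict_space borel (gcarrier G))"

definition gshift :: "grp \<Rightarrow> real set \<Rightarrow> real \<Rightarrow> real set" where
  "gshift G X g = (\<lambda>x. gadd G x g) ` X"

text \<open>Strongly continuous unitary representation. A representation of S^1 is given
 as a 2 pi-periodic representation of R.\<close>
definition scurep :: "grp \<Rightarrow> (real \<Rightarrow> 'a::chilbert \<Rightarrow> 'a) \<Rightarrow> bool" where
  "scurep G U \<longleftrightarrow> (\<forall>g. unitary (U g)) \<and> U 0 = id \<and> (\<forall>g h. U (g + h) = U g \<circ> U h)
     \<and> (\<forall>x. continuous_on UNIV (\<lambda>g. U g x)) \<and> (G = Circle \<longrightarrow> U (2*pi) = id)"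

definition pom :: "grp \<Rightarrow> (real set \<Rightarrow> 'a::chilbert \<Rightarrow> 'a) \<Rightarrow> bool" where
  "pom G F \<longleftrightarrow> (\<forall>X\<in>gsets G. positive_op (F X)) \<and> F (gcarrier G) = id \<and>
     (\<forall>Xs. range Xs \<subseteq> gsets G \<longrightarrow> disjoint_family Xs \<longrightarrow>
        (\<forall>x y. (\<lambda>n. cinner x (F (Xs n) y)) sums cinner x (F (\<Union>n. Xs n) y)))"

definition covariant :: "grp \<Rightarrow> (real \<Rightarrow> 'a::chilbert \<Rightarrow> 'a) \<Rightarrow> (real set \<Rightarrow> 'a \<Rightarrow> 'a) \<Rightarrow> bool" where
  "covariant G U F \<longleftrightarrow>
     (\<forall>g\<in>gcarrier G. \<forall>X\<in>gsets G. U g \<circ> F X \<circ> adj (U g) = F (gshift G X g))"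

definition norm1_property :: "grp \<Rightarrow> (real set \<Rightarrow> 'a::chilbert \<Rightarrow> 'a) \<Rightarrow> bool" where
  "norm1_property G F \<longleftrightarrow> (\<forall>X\<in>gsets G. F X \<noteq> (\<lambda>_. 0) \<longrightarrow>
     (\<exists>\<phi>. (\<forall>n. norm (\<phi> n) = 1) \<and> (\<lambda>n. cinner (\<phi> n) (F X (\<phi> n))) \<longlonglongrightarrow> 1))"

definition pom_measure :: "grp \<Rightarrow> (real set \<Rightarrow> 'a::chilbert \<Rightarrow> 'a) \<Rightarrow> 'a \<Rightarrow> real measure" where
  "pom_measure G F \<xi> = measure_of (gcarrier G) (gsets G) (\<lambda>X. ennreal (Re (cinner \<xi> (F X \<xi>))))"

text \<open>yen(A) = \<integral> U(g) A U(g)^* \<otimes> F(dg), defined weakly: the bounded operator on the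
 tensor product whose quadratic form on product vectors is given by the scalar integrals
 (this determines it uniquely, by polarisation).\<close>
definition yen :: "grp \<Rightarrow> (real \<Rightarrow> 'a::chilbert \<Rightarrow> 'a) \<Rightarrow> (real set \<Rightarrow> 'b::chilbert \<Rightarrow> 'b)
    \<Rightarrow> ('a \<Rightarrow> 'b \<Rightarrow> 'c::chilbert) \<Rightarrow> ('a \<Rightarrow> 'a) \<Rightarrow> ('c \<Rightarrow> 'c)" where
  "yen G U F t A = (THE Y. bop Y \<and> (\<forall>\<eta> \<xi>. cinner (t \<eta> \<xi>) (Y (t \<eta> \<xi>)) =
       integral\<^sup>L (pom_measure G F \<xi>) (\<lambda>g. cinner \<eta> (U g (A (adj (U g) \<eta>))))))"

definition Gamma :: "('a::chilbert \<Rightarrow> 'b::chilbert \<Rightarrow> 'c::chilbert) \<Rightarrow> 'b \<Rightarrow> ('c \<Rightarrow> 'c) \<Rightarrow> ('a \<Rightarrow> 'a)" where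
  "Gamma t \<phi> \<Lambda> = (THE Gm. bop Gm \<and> (\<forall>\<rho>. density \<rho> \<longrightarrow>
       trace (\<rho> \<circ> Gm) = trace (optens t \<rho> (ketbra \<phi>) \<circ> \<Lambda>)))"

end

theory Submission
  imports Defs
begin

text \<open>
  The operator \<open>\<yen>(A)\<close> is the weak integral of \<open>A\<^bsub>g\<^esub> = U(g) A U(g)\<^sup>*\<close>, so
  \<open>\<langle>\<eta> \<otimes> \<phi>, \<yen>(A) (\<eta> \<otimes> \<phi>)\<rangle>\<close> is the average of \<open>\<langle>\<eta>, A\<^bsub>g\<^esub> \<eta>\<rangle>\<close> over the probability
  measure \<open>\<mu>\<^bsub>\<phi>\<^esub>(X) = \<langle>\<phi>, F(X) \<phi>\<rangle>\<close>. If \<open>X\<close> is a neighbourhood of 0 then \<open>F(X) \<noteq> 0\<close>, because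
  countably many translates of \<open>X\<close> cover the group and covariance would give \<open>F(G) = 0\<close>. The norm-1
  property therefore yields unit vectors whose measures concentrate at 0, where \<open>A\<^bsub>g\<^esub> = A\<close>, and
  Tannery's theorem passes to the limit in the trace.

  The spectral theorem is avoided. A positive operator on a separable space is a weakly convergent
  sum of rank one operators \<open>|v\<^bsub>m\<^esub>\<rangle>\<langle>v\<^bsub>m\<^esub>|\<close>: run the Cholesky algorithm along a dense sequence. For a
  density operator \<open>\<rho>\<close> the sum of \<open>\<parallel>v\<^bsub>m\<^esub>\<parallel>\<^sup>2\<close> is finite, whence \<open>tr(\<rho> B)\<close> is the sum of
  \<open>\<langle>v\<^bsub>m\<^esub>, B v\<^bsub>m\<^esub>\<rangle>\<close> in every basis. Applied to \<open>F(X)\<close>, the same decomposition bounds the Riemann sums of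
  \<open>\<integral> A\<^bsub>g\<^esub> \<otimes> F(dg)\<close> uniformly on the algebraic tensor product, which gives the existence of
  \<open>\<yen>(A)\<close>.
\<close>

section \<open>Elementary Hilbert space facts\<close>

lemma cinner_add_left: "cinner (x + y) z = cinner x z + cinner (y::'a::chilbert) z"
  by (metis cinner_conj cinner_add_right complex_cnj_add)

lemma cinner_cscale_left: "cinner (cscale c x) y = cnj c * cinner x (y::'a::chilbert)"
  by (metis cinner_conj cinner_cscale_right complex_cnj_mult)

lemma cscale_zero_left [simp]: "cscale 0 x = (0::'a::chilbert)"
  by (metis of_real_0 scaleR_cscale scaleR_zero_left)

lemma cscale_zero_right [simp]: "cscale c 0 = (0::'a::chilbert)"
  by (metis add_cancel_right_right cscale_add_right)

lemma cscale_minus_one: "cscale (-1) x = - (x::'a::chilbert)"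
  by (metis of_real_1 of_real_minus scaleR_cscale scaleR_minus1_left)

lemma cscale_minus_right: "cscale c (- x) = - cscale c (x::'a::chilbert)"
  by (metis cscale_cscale cscale_minus_one mult.commute)

lemma cscale_minus_left: "cscale (- c) x = - cscale c (x::'a::chilbert)"
  by (metis cscale_cscale cscale_minus_one mult_minus1)

lemma cscale_diff_right: "cscale c (x - y) = cscale c x - cscale c (y::'a::chilbert)"
  by (metis cscale_add_right cscale_minus_right uminus_add_conv_diff add.commute)

lemma cscale_diff_left: "cscale (a - b) x = cscale a x - cscale b (x::'a::chilbert)"
  by (metis cscale_add_left cscale_minus_left uminus_add_conv_diff add.commute)

lemma cscale_sum_right: "cscale c (\<Sum>i\<in>I. f i) = (\<Sum>i\<in>I. cscale c (f i :: 'a::chilbert))"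
  by (induction I rule: infinite_finite_induct) (auto simp: cscale_add_right)

lemma cinner_zero_right [simp]: "cinner x (0::'a::chilbert) = 0"
  by (metis add_cancel_right_right cinner_add_right)

lemma cinner_zero_left [simp]: "cinner (0::'a::chilbert) x = 0"
  by (metis cinner_conj cinner_zero_right complex_cnj_zero)

lemma cinner_minus_right [simp]: "cinner x (- y) = - cinner x (y::'a::chilbert)"
  by (metis cinner_cscale_right cscale_minus_one mult_minus1)

lemma cinner_minus_left [simp]: "cinner (- x) y = - cinner x (y::'a::chilbert)"
  by (metis cinner_conj cinner_minus_right complex_cnj_minus)

lemma cinner_diff_right: "cinner x (y - z) = cinner x y - cinner x (z::'a::chilbert)"
  by (metis cinner_add_right cinner_minus_right uminus_add_conv_diff add.commute)

lemma cinner_diff_left: "cinner (x - y) z = cinner x z - cinner (y::'a::chilbert) z"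
  by (metis cinner_add_left cinner_minus_left uminus_add_conv_diff add.commute)

lemma cinner_sum_right: "cinner x (\<Sum>i\<in>I. f i) = (\<Sum>i\<in>I. cinner x (f i :: 'a::chilbert))"
  by (induction I rule: infinite_finite_induct) (auto simp: cinner_add_right)

lemma cinner_sum_left: "cinner (\<Sum>i\<in>I. f i) x = (\<Sum>i\<in>I. cinner (f i :: 'a::chilbert) x)"
  by (induction I rule: infinite_finite_induct) (auto simp: cinner_add_left)

lemma cinner_self: "cinner x x = complex_of_real ((norm (x::'a::chilbert))\<^sup>2)"
proof -
  have im: "Im (cinner x x) = 0"
    by (metis cinner_conj complex_cnj_cancel_iff Reals_cnj_iff complex_is_Real_iff)
  have "sqrt (Re (cinner x x)) \<ge> 0" by (metis norm_cinner norm_ge_zero)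
  hence "Re (cinner x x) \<ge> 0" by simp
  hence "(norm x)\<^sup>2 = Re (cinner x x)" by (simp add: norm_cinner)
  with im show ?thesis by (simp add: complex_eq_iff)
qed

lemma Re_cinner_commute: "Re (cinner x y) = Re (cinner y (x::'a::chilbert))"
  by (metis cinner_conj complex_cnj(1) cnj.sel(1))

lemma norm_diff_sq: "(norm (x - y))\<^sup>2 = (norm x)\<^sup>2 - 2 * Re (cinner x y) + (norm (y::'a::chilbert))\<^sup>2"
proof -
  have "complex_of_real ((norm (x - y))\<^sup>2) = cinner (x - y) (x - y)" by (simp only: cinner_self)
  hence "(norm (x - y))\<^sup>2 = Re (cinner (x - y) (x - y))" by (metis Re_complex_of_real)
  also have "\<dots> = Re (cinner x x) - Re (cinner x y) - Re (cinner y x) + Re (cinner y y)"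
    by (simp add: cinner_diff_left cinner_diff_right)
  also have "\<dots> = (norm x)\<^sup>2 - 2 * Re (cinner x y) + (norm y)\<^sup>2"
    using Re_cinner_commute[of x y] by (simp add: cinner_self)
  finally show ?thesis .
qed

lemma norm_add_sq: "(norm (x + y))\<^sup>2 = (norm x)\<^sup>2 + 2 * Re (cinner x y) + (norm (y::'a::chilbert))\<^sup>2"
  using norm_diff_sq[of x "- y"] by simp

lemma norm_cscale [simp]: "norm (cscale c x) = cmod c * norm (x::'a::chilbert)"
proof -
  have "complex_of_real ((norm (cscale c x))\<^sup>2) = cinner (cscale c x) (cscale c x)"
    by (simp only: cinner_self)
  also have "\<dots> = (c * cnj c) * cinner x x"
    by (simp add: cinner_cscale_left cinner_cscale_right)
  also have "\<dots> = complex_of_real ((cmod c * norm x)\<^sup>2)"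
    by (simp add: complex_norm_square[symmetric] cinner_self power_mult_distrib)
  finally have "(norm (cscale c x))\<^sup>2 = (cmod c * norm x)\<^sup>2" by (simp only: of_real_eq_iff)
  thus ?thesis by (metis norm_ge_zero mult_nonneg_nonneg power2_eq_imp_eq)
qed

lemma bopD:
  assumes "bop A"
  shows "A (x + y) = A x + A y" "A (cscale c x) = cscale c (A x)" "A 0 = 0" "A (- x) = - A x"
    "A (x - y) = A x - A y"
proof -
  show add: "A (x + y) = A x + A y" and sc: "A (cscale c x) = cscale c (A x)" for x y c
    using assms by (auto simp: bop_def clinear_def)
  show "A 0 = 0" using sc[of 0 0] by simp
  show m: "A (- x) = - A x" for x using sc[of "-1" x] by (simp add: cscale_minus_one)
  show "A (x - y) = A x - A y" using add[of x "- y"] m[of y] by simp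
qed

lemma bop_sum: "bop A \<Longrightarrow> A (\<Sum>i\<in>I. f i) = (\<Sum>i\<in>I. A (f i))"
  by (induction I rule: infinite_finite_induct) (auto simp: bopD)

lemma bop_bound:
  assumes "bop A"
  obtains K where "K > 0" "\<And>x. norm (A x) \<le> K * norm x"
proof -
  obtain K where K: "\<And>x. norm (A x) \<le> K * norm x" using assms by (auto simp: bop_def)
  have "norm (A x) \<le> (\<bar>K\<bar> + 1) * norm x" for x
    by (rule order_trans[OF K mult_right_mono]) auto
  thus ?thesis using that[of "\<bar>K\<bar> + 1"] by auto
qed

lemma bopI:
  assumes "\<And>x y. A (x + y) = A x + A y" "\<And>c x. A (cscale c x) = cscale c (A x)"
    "\<And>x. norm (A x) \<le> K * norm x"
  shows "bop A"
  using assms by (auto simp: bop_def clinear_def)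

lemma bop_bounded_linear:
  assumes "bop A" shows "bounded_linear A"
proof -
  obtain K where "K > 0" "\<And>x. norm (A x) \<le> K * norm x" using bop_bound[OF assms] by metis
  thus ?thesis
    by (intro bounded_linear_intro[where K = K])
      (auto simp: bopD[OF assms] scaleR_cscale mult.commute)
qed

lemma bop_comp:
  assumes "bop A" "bop B" shows "bop (A \<circ> B)"
proof -
  obtain K where K: "K > 0" "\<And>x. norm (A x) \<le> K * norm x" using bop_bound[OF assms(1)] by metis
  obtain L where L: "L > 0" "\<And>x. norm (B x) \<le> L * norm x" using bop_bound[OF assms(2)] by metis
  show ?thesis
  proof (rule bopI[where K = "K * L"])
    show "norm ((A \<circ> B) x) \<le> K * L * norm x" for x
      using order_trans[OF K(2)[of "B x"] mult_left_mono[OF L(2)[of x]]] K(1) by (simp add: mult_ac)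
  qed (use assms in \<open>auto simp: bopD\<close>)
qed

lemma bop_id: "bop id"
  by (rule bopI[where K = 1]) auto

section \<open>Positive operators: hermiticity and Cauchy-Schwarz\<close>

lemma positive_op_id: "positive_op id"
  by (simp add: positive_op_def bop_id cinner_self)

lemma positive_op_bop: "positive_op P \<Longrightarrow> bop P"
  by (simp add: positive_op_def)

text \<open>Over the complex field the quadratic form determines the operator. Conjugate linearity
  of \<open>cinner\<close> in its first argument fixes the signs of the two \<open>\<i>\<close>
  terms.\<close>

lemma polarization:
  assumes "bop (A :: 'a::chilbert \<Rightarrow> 'a)"
  shows "4 * cinner x (A y) = cinner (x + y) (A (x + y)) - cinner (x - y) (A (x - y))
      - \<i> * cinner (x + cscale \<i> y) (A (x + cscale \<i> y))
      + \<i> * cinner (x - cscale \<i> y) (A (x - cscale \<i> y))"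
  by (simp add: bopD[OF assms] cinner_add_left cinner_add_right cinner_diff_left cinner_diff_right
      cinner_cscale_left cinner_cscale_right algebra_simps)

lemma positive_op_hermitian:
  assumes "positive_op P"
  shows "cinner x (P y) = cinner (P x) y"
proof -
  note b = bopD[OF positive_op_bop[OF assms]]
  have r: "cnj (cinner z (P z)) = cinner z (P z)" for z
    using assms by (simp add: positive_op_def complex_eq_iff)
  \<comment> \<open>The form does not change when its vector is multiplied by a scalar of modulus 1:
    first by -1, then by \<open>\<i>\<close> and \<open>-\<i>\<close>, since x + \<i>y = \<i>(y -
    \<i>x). As its values are real, conjugating the polarisation of \<open>cinner y (P x)\<close>
    yields that of \<open>cinner x (P y)\<close>.\<close>
  have sw: "cinner (x - y) (P (x - y)) = cinner (y - x) (P (y - x))"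
    by (simp add: b cinner_diff_left cinner_diff_right)
  have iy: "cinner (x + cscale \<i> y) (P (x + cscale \<i> y)) = cinner (y - cscale \<i> x) (P (y - cscale \<i> x))"
    "cinner (x - cscale \<i> y) (P (x - cscale \<i> y)) = cinner (y + cscale \<i> x) (P (y + cscale \<i> x))"
    by (simp_all add: b cinner_diff_left cinner_diff_right cinner_add_left cinner_add_right
        cinner_cscale_left cinner_cscale_right algebra_simps)
  have "4 * cnj (cinner y (P x)) = 4 * cinner x (P y)"
    using arg_cong[OF polarization[OF positive_op_bop[OF assms], of y x], of cnj]
      polarization[OF positive_op_bop[OF assms], of x y]
    by (simp add: r sw iy add.commute)
  thus ?thesis by (simp add: cinner_conj[of "P x" y])
qed

text \<open>The discriminant criterion: evaluate at the minimiser -b/c. For c = 0 the polynomial is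
  affine, and a nonzero slope would give the value -1 at r = -(a + 1)/(2b).\<close>

lemma quadratic_nonneg_imp_sq_le:
  fixes a b c :: real
  assumes "\<And>r. 0 \<le> a + 2 * r * b + r\<^sup>2 * c" and "0 \<le> c"
  shows "b\<^sup>2 \<le> a * c"
proof (cases "c = 0")
  case True
  have "b = 0"
  proof (rule ccontr)
    assume "b \<noteq> 0"
    thus False using assms(1)[of "- (a + 1) / (2 * b)"] True by (simp add: field_simps)
  qed
  thus ?thesis using True by simp
next
  case False
  thus ?thesis using assms(1)[of "- b / c"] assms(2) by (simp add: field_simps power2_eq_square)
qed

lemma positive_op_cauchy_schwarz:
  assumes "positive_op P"
  shows "(cmod (cinner x (P y)))\<^sup>2 \<le> Re (cinner x (P x)) * Re (cinner y (P y))"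
proof (rule quadratic_nonneg_imp_sq_le)
  note b = bopD[OF positive_op_bop[OF assms]]
  show "0 \<le> Re (cinner y (P y))" using assms by (simp add: positive_op_def)
  fix r :: real
  let ?z = "cinner x (P y)"
  \<comment> \<open>The phase \<open>u\<close> makes the cross term real and nonnegative, so along x
    + r u y the form is a real quadratic polynomial in r with middle coefficient
    \<open>cmod ?z\<close>.\<close>
  obtain u where u: "u * cnj u = 1" "?z * u = complex_of_real (cmod ?z)"
  proof (cases "?z = 0")
    case True thus ?thesis using that[of 1] by simp
  next
    case False
    have "?z * cnj ?z = (complex_of_real (cmod ?z))\<^sup>2" by (metis complex_norm_square of_real_power)
    thus ?thesis using False
      by (intro that[of "cnj ?z / complex_of_real (cmod ?z)"])
        (auto simp: field_simps simp flip: power2_eq_square)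
  qed
  define s where "s = complex_of_real r * u"
  have 1: "Re (s * ?z) = r * cmod ?z" using u(2) by (simp add: s_def mult.assoc mult.commute[of u])
  have 2: "cnj s * cinner y (P x) = cnj (s * ?z)"
    using cinner_conj[of y "P x"] positive_op_hermitian[OF assms, of x y] by simp
  have 3: "cnj s * s = complex_of_real (r\<^sup>2)"
    using u(1) by (simp add: s_def power2_eq_square mult_ac)
  have "cinner (x + cscale s y) (P (x + cscale s y))
      = cinner x (P x) + s * ?z + cnj s * cinner y (P x) + (cnj s * s) * cinner y (P y)"
    by (simp add: b cinner_add_left cinner_add_right cinner_cscale_left cinner_cscale_right
        algebra_simps)
  hence "Re (cinner (x + cscale s y) (P (x + cscale s y)))
      = Re (cinner x (P x)) + 2 * r * cmod ?z + r\<^sup>2 * Re (cinner y (P y))"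
    using 1 unfolding 2 3 by simp
  thus "0 \<le> Re (cinner x (P x)) + 2 * r * cmod ?z + r\<^sup>2 * Re (cinner y (P y))"
    using assms by (metis positive_op_def)
qed

lemma cmod_cinner_le: "cmod (cinner x y) \<le> norm x * norm (y::'a::chilbert)"
proof -
  have "(cmod (cinner x y))\<^sup>2 \<le> (norm x * norm y)\<^sup>2"
    using positive_op_cauchy_schwarz[OF positive_op_id, of x y]
    by (simp add: cinner_self power_mult_distrib)
  thus ?thesis by (rule power2_le_imp_le) simp
qed

lemma bounded_bilinear_cinner: "bounded_bilinear (cinner :: 'a::chilbert \<Rightarrow> 'a \<Rightarrow> complex)"
  by (rule bounded_bilinear.intro)
    (auto simp: cinner_add_left cinner_add_right scaleR_cscale cinner_cscale_left
      cinner_cscale_right scaleR_conv_of_real intro!: exI[of _ 1] cmod_cinner_le)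

lemmas tendsto_cinner [tendsto_intros] = bounded_bilinear.tendsto[OF bounded_bilinear_cinner]
lemmas continuous_on_cinner [continuous_intros] =
  bounded_bilinear.continuous_on[OF bounded_bilinear_cinner]

lemma bounded_bilinear_cscale: "bounded_bilinear (cscale :: complex \<Rightarrow> 'a::chilbert \<Rightarrow> 'a)"
  by (rule bounded_bilinear.intro)
    (auto simp: cscale_add_left cscale_add_right scaleR_cscale cscale_cscale
      scaleR_conv_of_real mult.commute intro!: exI[of _ 1])

lemmas tendsto_cscale [tendsto_intros] = bounded_bilinear.tendsto[OF bounded_bilinear_cscale]

lemma cinner_ext: "(\<And>z. cinner z x = cinner z y) \<Longrightarrow> x = (y::'a::chilbert)"
  by (metis cinner_diff_right cinner_self diff_self eq_iff_diff_eq_0 norm_eq_zero of_real_eq_0_iff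
      zero_eq_power2)

lemma cinner_ext_left: "(\<And>z. cinner x z = cinner y z) \<Longrightarrow> x = (y::'a::chilbert)"
  by (metis cinner_conj cinner_ext)

lemma bop_eqI_quadratic:
  assumes "bop (A :: 'a::chilbert \<Rightarrow> 'a)" "bop B" "\<And>x. cinner x (A x) = cinner x (B x)"
  shows "A = B"
proof
  fix y
  have "4 * cinner x (A y) = 4 * cinner x (B y)" for x
    by (simp only: polarization[OF assms(1)] polarization[OF assms(2)] assms(3))
  thus "A y = B y" by (intro cinner_ext) simp
qed

section \<open>Riesz representation, adjoints and orthonormal bases\<close>

text \<open>With the scalars as a Hilbert space, bounded functionals become a case of
  \<open>bop\<close>, and results on operators apply to them.\<close>

instantiation complex :: chilbert
begin
definition "cscale_complex = ((*) :: complex \<Rightarrow> complex \<Rightarrow> complex)"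
definition "cinner_complex x y = cnj x * (y::complex)"
instance
proof
  fix x :: complex
  show "norm x = sqrt (Re (cinner x x))"
    by (simp add: cinner_complex_def cmod_def power2_eq_square)
qed (auto simp: cscale_complex_def cinner_complex_def algebra_simps scaleR_conv_of_real)
end

text \<open>By the parallelogram law two nearly minimal vectors are close, because their midpoint
  still has norm at least the infimum; hence a minimising sequence is Cauchy. It is applied to an
  affine hyperplane and to a coset of a closed span.\<close>

lemma min_norm_exists:
  fixes C :: "'a::chilbert set"
  assumes "closed C" "C \<noteq> {}" and mid: "\<And>x y. x \<in> C \<Longrightarrow> y \<in> C \<Longrightarrow> (1/2) *\<^sub>R (x + y) \<in> C"
  shows "\<exists>z\<in>C. \<forall>x\<in>C. norm z \<le> norm x"
proof -
  define d where "d = Inf (norm ` C)"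
  have bdd: "bdd_below (norm ` C)" by (rule bdd_belowI[of _ 0]) auto
  have d: "d \<le> norm x" if "x \<in> C" for x
    unfolding d_def using that bdd by (intro cInf_lower) auto
  have d0: "0 \<le> d" unfolding d_def using assms(2) by (intro cInf_greatest) auto
  have "\<exists>x\<in>C. norm x < d + inverse (real (Suc n))" for n
    using cInf_lessD[of "norm ` C" "d + inverse (real (Suc n))"] assms(2)
    by (auto simp: d_def)
  then obtain xs where xs: "\<And>n. xs n \<in> C" "\<And>n. norm (xs n) < d + inverse (real (Suc n))" by metis
  have par: "(norm (x - y))\<^sup>2 \<le> 4 * ((d + r)\<^sup>2 - d\<^sup>2)"
    if "x \<in> C" "y \<in> C" "norm x \<le> d + r" "norm y \<le> d + r" for x y r
  proof -
    have "d \<le> norm ((1/2) *\<^sub>R (x + y))" using that mid d by blast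
    hence "2 * d \<le> norm (x + y)" by simp
    hence "(2 * d)\<^sup>2 \<le> (norm (x + y))\<^sup>2" using d0 by (intro power_mono) auto
    moreover have "(norm x)\<^sup>2 \<le> (d + r)\<^sup>2" "(norm y)\<^sup>2 \<le> (d + r)\<^sup>2"
      using that by (auto intro: power_mono)
    ultimately show ?thesis
      using norm_diff_sq[of x y] norm_add_sq[of x y] by (simp add: power_mult_distrib)
  qed
  have "Cauchy xs"
  proof (rule CauchyI)
    fix e :: real assume e: "0 < e"
    have "(\<lambda>n. 4 * ((d + inverse (real (Suc n)))\<^sup>2 - d\<^sup>2)) \<longlonglongrightarrow> 4 * ((d + 0)\<^sup>2 - d\<^sup>2)"
      by (intro tendsto_intros LIMSEQ_inverse_real_of_nat)
    hence "eventually (\<lambda>n. 4 * ((d + inverse (real (Suc n)))\<^sup>2 - d\<^sup>2) < e\<^sup>2) sequentially"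
      using e by (intro order_tendstoD(2)) auto
    then obtain M where M: "4 * ((d + inverse (real (Suc M)))\<^sup>2 - d\<^sup>2) < e\<^sup>2"
      by (auto simp: eventually_sequentially)
    have le: "norm (xs n) \<le> d + inverse (real (Suc M))" if "n \<ge> M" for n
    proof -
      have "inverse (real (Suc n)) \<le> inverse (real (Suc M))" using that by (intro le_imp_inverse_le) auto
      thus ?thesis using xs(2)[of n] by linarith
    qed
    have "norm (xs m - xs n) < e" if "m \<ge> M" "n \<ge> M" for m n
      using par[OF xs(1) xs(1) le[OF that(1)] le[OF that(2)]] M e
      by (intro power_less_imp_less_base[of _ 2 e]) auto
    thus "\<exists>M. \<forall>m\<ge>M. \<forall>n\<ge>M. norm (xs m - xs n) < e" by blast
  qed
  then obtain z where z: "xs \<longlonglongrightarrow> z" by (auto simp: Cauchy_convergent_iff convergent_def)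
  have "z \<in> C" using z xs(1) assms(1) closed_sequentially by blast
  moreover have "norm z \<le> d + 0"
  proof (rule LIMSEQ_le)
    show "(\<lambda>n. norm (xs n)) \<longlonglongrightarrow> norm z" by (intro tendsto_intros z)
    show "(\<lambda>n. d + inverse (real (Suc n))) \<longlonglongrightarrow> d + 0"
      by (intro tendsto_intros LIMSEQ_inverse_real_of_nat)
  qed (use xs(2) less_imp_le in blast)
  ultimately show ?thesis using d by force
qed

text \<open>The first variation of the squared norm at a minimiser vanishes in every complex
  multiple of the direction \<open>h\<close>.\<close>

lemma min_norm_orthogonal:
  fixes z :: "'a::chilbert"
  assumes "\<And>c. norm z \<le> norm (z + cscale c h)"
  shows "cinner z h = 0"
proof -
  have R: "Re (u * cinner z h) = 0" for u
  proof -
    \<comment> \<open>The constant term 0 makes the discriminant criterion force the linear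
      coefficient to vanish.\<close>
    have "0 \<le> 0 + 2 * r * Re (u * cinner z h) + r\<^sup>2 * (norm (cscale u h))\<^sup>2" for r
    proof -
      have "(norm z)\<^sup>2 \<le> (norm (z + cscale (complex_of_real r * u) h))\<^sup>2"
        using assms by (intro power_mono) auto
      thus ?thesis
        by (simp add: norm_add_sq cinner_cscale_right norm_mult power_mult_distrib mult.assoc)
    qed
    hence "(Re (u * cinner z h))\<^sup>2 \<le> 0 * (norm (cscale u h))\<^sup>2"
      by (rule quadratic_nonneg_imp_sq_le) simp
    thus ?thesis by simp
  qed
  show ?thesis using R[of 1] R[of \<i>] by (simp add: complex_eq_iff)
qed

text \<open>The shortest vector \<open>z\<close> of the hyperplane f = 1 is orthogonal to the kernel
  of \<open>f\<close>. Since x - f(x) z lies in that kernel, a rescaling of \<open>z\<close>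
  represents \<open>f\<close>.\<close>

lemma riesz_representation:
  fixes f :: "'a::chilbert \<Rightarrow> complex"
  assumes "bop f"
  shows "\<exists>y. \<forall>x. f x = cinner y x"
proof (cases "\<forall>x. f x = 0")
  case True
  thus ?thesis by (intro exI[of _ 0]) simp
next
  case False
  note b = bopD[OF assms, unfolded cscale_complex_def]
  let ?C = "{x. f x = 1}"
  have "continuous_on UNIV f"
    using bop_bounded_linear[OF assms] by (simp add: linear_continuous_on)
  hence "closed ?C" by (intro closed_Collect_eq continuous_intros)
  moreover obtain x0 where "f x0 \<noteq> 0" using False by blast
  hence "cscale (1 / f x0) x0 \<in> ?C" by (simp add: b)
  hence "?C \<noteq> {}" by blast
  ultimately obtain z where z: "f z = 1" "\<And>x. f x = 1 \<Longrightarrow> norm z \<le> norm x"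
    using min_norm_exists[of ?C] by (auto simp: scaleR_cscale b)
  have orth: "cinner z h = 0" if "f h = 0" for h
    by (rule min_norm_orthogonal) (simp add: z b that)
  have "z \<noteq> 0" using z(1) b(3) by auto
  have "f x = cinner (cscale (complex_of_real (1 / (norm z)\<^sup>2)) z) x" for x
  proof -
    have "cinner z (x - cscale (f x) z) = 0" by (rule orth) (simp add: b z(1))
    hence "cinner z x = f x * complex_of_real ((norm z)\<^sup>2)"
      by (simp add: cinner_diff_right cinner_cscale_right cinner_self)
    thus ?thesis using \<open>z \<noteq> 0\<close> by (simp add: cinner_cscale_left)
  qed
  thus ?thesis by blast
qed

text \<open>Riesz gives \<open>B x\<close> for each \<open>x\<close> separately. The norm bound
  comes from testing the defining identity at y = \<open>B x\<close>.\<close>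

lemma hilbert_adjoint_exists:
  fixes A :: "'a::chilbert \<Rightarrow> 'b::chilbert"
  assumes "bop A"
  shows "\<exists>B. bop B \<and> (\<forall>x y. cinner (B x) y = cinner x (A y))"
proof -
  obtain K where K: "K > 0" "\<And>x. norm (A x) \<le> K * norm x" using bop_bound[OF assms] by metis
  have "\<exists>z. \<forall>y. cinner x (A y) = cinner z y" for x
  proof (rule riesz_representation, rule bopI[where K = "norm x * K"])
    show "norm (cinner x (A y)) \<le> norm x * K * norm y" for y
      using order_trans[OF cmod_cinner_le mult_left_mono[OF K(2) norm_ge_zero]] by (simp add: mult.assoc)
  qed (simp_all add: bopD[OF assms] cinner_add_right cinner_cscale_right cscale_complex_def)
  then obtain B where B: "\<And>x y. cinner x (A y) = cinner (B x) y" by metis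
  have "bop B"
  proof (rule bopI[where K = K])
    show "B (x + y) = B x + B y" for x y
      by (rule cinner_ext_left) (simp add: B[symmetric] cinner_add_left)
    show "B (cscale c x) = cscale c (B x)" for c x
      by (rule cinner_ext_left) (simp add: B[symmetric] cinner_cscale_left)
    show "norm (B x) \<le> K * norm x" for x
    proof (cases "B x = 0")
      case False
      have "(norm (B x))\<^sup>2 = cmod (cinner x (A (B x)))" by (simp add: B cinner_self norm_power)
      also have "\<dots> \<le> norm x * (K * norm (B x))"
        by (rule order_trans[OF cmod_cinner_le mult_left_mono[OF K(2) norm_ge_zero]])
      finally show ?thesis using False by (simp add: power2_eq_square mult_ac)
    qed (use K in simp)
  qed
  thus ?thesis using B by metis
qed

section \<open>Linear spans, their closures and orthonormal bases\<close>

lemma cspan_add: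
  assumes "x \<in> cspan S" "y \<in> cspan S"
  shows "x + y \<in> cspan S"
proof -
  obtain T c where T: "finite T" "T \<subseteq> S" "x = (\<Sum>s\<in>T. cscale (c s) s)"
    using assms(1) by (auto simp: cspan_def)
  obtain T' c' where T': "finite T'" "T' \<subseteq> S" "y = (\<Sum>s\<in>T'. cscale (c' s) s)"
    using assms(2) by (auto simp: cspan_def)
  have "x = (\<Sum>s\<in>T \<union> T'. cscale (if s \<in> T then c s else 0) s)"
    unfolding T(3) by (rule sum.mono_neutral_cong_left) (use T T' in auto)
  moreover have "y = (\<Sum>s\<in>T \<union> T'. cscale (if s \<in> T' then c' s else 0) s)"
    unfolding T'(3) by (rule sum.mono_neutral_cong_left) (use T T' in auto)
  ultimately have "x + y = (\<Sum>s\<in>T \<union> T'. cscale ((if s \<in> T then c s else 0) + (if s \<in> T' then c' s else 0)) s)"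
    by (simp add: cscale_add_left sum.distrib)
  thus ?thesis unfolding cspan_def using T(1,2) T'(1,2)
    by (intro CollectI exI[of _ "T \<union> T'"]
        exI[of _ "\<lambda>s. (if s \<in> T then c s else 0) + (if s \<in> T' then c' s else 0)"]) auto
qed

lemma cspan_cscale:
  assumes "x \<in> cspan S" shows "cscale a x \<in> cspan S"
proof -
  obtain T c where T: "finite T" "T \<subseteq> S" "x = (\<Sum>s\<in>T. cscale (c s) s)"
    using assms by (auto simp: cspan_def)
  thus ?thesis unfolding cspan_def
    by (intro CollectI exI[of _ T] exI[of _ "\<lambda>s. a * c s"]) (simp add: cscale_sum_right cscale_cscale)
qed

lemma cspan_base: "x \<in> S \<Longrightarrow> x \<in> cspan S"
  unfolding cspan_def by (intro CollectI exI[of _ "{x}"] exI[of _ "\<lambda>_. 1"]) (simp add: cscale_one)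

lemma closure_cspan_add:
  assumes "x \<in> closure (cspan S)" "y \<in> closure (cspan S)"
  shows "x + y \<in> closure (cspan S)"
proof -
  obtain f g where "\<And>n. f n \<in> cspan S" "f \<longlonglongrightarrow> x" "\<And>n. g n \<in> cspan S" "g \<longlonglongrightarrow> y"
    using assms unfolding closure_sequential by blast
  thus ?thesis unfolding closure_sequential
    by (intro exI[of _ "\<lambda>n. f n + g n"]) (auto intro: cspan_add tendsto_add)
qed

lemma closure_cspan_cscale:
  assumes "x \<in> closure (cspan S)"
  shows "cscale c x \<in> closure (cspan S)"
proof -
  obtain f where "\<And>n. f n \<in> cspan S" "f \<longlonglongrightarrow> x"
    using assms unfolding closure_sequential by blast
  thus ?thesis unfolding closure_sequential
    by (intro exI[of _ "\<lambda>n. cscale c (f n)"])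
      (auto intro: cspan_cscale tendsto_cscale[OF tendsto_const])
qed

lemma bop_eqI_dense:
  fixes A :: "'a::chilbert \<Rightarrow> 'b::chilbert"
  assumes "bop A" "bop B" "closure (cspan S) = UNIV" "\<And>x. x \<in> S \<Longrightarrow> A x = B x"
  shows "A = B"
proof -
  have "closed {x. A x = B x}"
    using assms(1,2) by (intro closed_Collect_eq linear_continuous_on bop_bounded_linear)
  moreover have "cspan S \<subseteq> {x. A x = B x}"
    using assms(4) by (auto simp: cspan_def bop_sum[OF assms(1)] bop_sum[OF assms(2)]
        bopD[OF assms(1)] bopD[OF assms(2)] subset_iff intro!: sum.cong arg_cong2[where f = cscale])
  ultimately have "closure (cspan S) \<subseteq> {x. A x = B x}" by (rule closure_minimal[rotated])
  thus ?thesis using assms(3) by auto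
qed

text \<open>\<open>trace\<close> is evaluated in a basis taken by \<open>SOME\<close>, so one has to
  exist. Zorn's lemma gives a maximal orthonormal set; a vector outside its closed span would leave
  a nonzero residual orthogonal to the set, contradicting maximality.\<close>

lemma onb_exists: "\<exists>B :: 'a::chilbert set. onb B"
proof -
  define \<A> where "\<A> = {B :: 'a set. (\<forall>e\<in>B. norm e = 1) \<and> (\<forall>e\<in>B. \<forall>f\<in>B. e \<noteq> f \<longrightarrow> cinner e f = 0)}"
  have "\<exists>M\<in>\<A>. \<forall>X\<in>\<A>. M \<subseteq> X \<longrightarrow> X = M"
  proof (rule subset_Zorn_nonempty)
    have "{} \<in> \<A>" by (simp add: \<A>_def)
    thus "\<A> \<noteq> {}" by blast
    fix C assume C: "C \<noteq> {}" "subset.chain \<A> C"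
    have sub: "C \<subseteq> \<A>" using C(2) by (auto simp: subset.chain_def)
    have "cinner e f = 0" if "X \<in> C" "Y \<in> C" "e \<in> X" "f \<in> Y" "e \<noteq> f" for e f X Y
    proof -
      have "X \<subseteq> Y \<or> Y \<subseteq> X" using C(2) that(1,2) by (auto simp: subset.chain_def)
      thus ?thesis using that sub by (auto simp: \<A>_def subset_iff)
    qed
    thus "\<Union>C \<in> \<A>" using sub by (auto simp: \<A>_def)
  qed
  then obtain M where M: "M \<in> \<A>" "\<And>X. X \<in> \<A> \<Longrightarrow> M \<subseteq> X \<Longrightarrow> X = M" by blast
  have "x \<in> closure (cspan M)" for x
  proof (rule ccontr)
    let ?S = "closure (cspan M)"
    assume x: "x \<notin> ?S"
    \<comment> \<open>The shortest element of this coset is the residual of the orthogonal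
      projection of \<open>x\<close> onto the closed span.\<close>
    let ?C = "{y. x - y \<in> ?S}"
    have "closed ?C"
      using continuous_closed_vimage[of ?S "\<lambda>y. x - y"] by (auto simp: vimage_def)
    moreover have "0 \<in> ?S"
      using closure_subset[of "cspan M"] by (auto simp: cspan_def intro!: exI[of _ "{}"])
    hence "?C \<noteq> {}" by (metis (mono_tags) diff_self empty_iff mem_Collect_eq)
    moreover have "(1/2) *\<^sub>R (y + z) \<in> ?C" if "y \<in> ?C" "z \<in> ?C" for y z
    proof -
      have "x - (1/2) *\<^sub>R (y + z) = cscale (1/2) ((x - y) + (x - z))"
        using scaleR_cscale[of "1/2" "(x - y) + (x - z)"] by (simp add: algebra_simps flip: scaleR_2)
      thus ?thesis using that by (auto intro: closure_cspan_add closure_cspan_cscale)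
    qed
    ultimately obtain z where z: "x - z \<in> ?S" "\<And>y. x - y \<in> ?S \<Longrightarrow> norm z \<le> norm y"
      using min_norm_exists[of ?C] by auto
    have "z \<noteq> 0" using x z(1) by auto
    have orth: "cinner z e = 0" if "e \<in> M" for e
    proof (rule min_norm_orthogonal, rule z(2))
      fix c
      have eq: "x - (z + cscale c e) = (x - z) + cscale (- c) e" by (simp add: cscale_minus_left)
      have "cscale (- c) e \<in> ?S"
        using that cspan_cscale[OF cspan_base] closure_subset by fastforce
      thus "x - (z + cscale c e) \<in> ?S" unfolding eq by (rule closure_cspan_add[OF z(1)])
    qed
    define e where "e = cscale (complex_of_real (1 / norm z)) z"
    have e: "norm e = 1" using \<open>z \<noteq> 0\<close> by (simp add: e_def norm_divide)
    have "cinner e f = 0 \<and> cinner f e = 0" if "f \<in> M" for f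
      using orth[OF that] cinner_conj[of f z] by (simp add: e_def cinner_cscale_left cinner_cscale_right)
    hence "insert e M \<in> \<A>" using M(1) e by (auto simp: \<A>_def)
    hence "e \<in> M" using M(2)[of "insert e M"] by blast
    hence "cinner z e = 0" by (rule orth)
    thus False using \<open>z \<noteq> 0\<close> by (simp add: e_def cinner_cscale_right cinner_self)
  qed
  hence "onb M" using M(1) by (auto simp: onb_def \<A>_def)
  thus ?thesis by blast
qed

text \<open>A Fourier partial sum over \<open>T\<close> is the best approximation among combinations
  of \<open>T\<close>. Once \<open>T\<close> contains the support of a good approximant
  \<open>s\<close>, it is therefore at least as good as \<open>s\<close>.\<close>

lemma onb_expansion:
  assumes "onb B"
  shows "((\<lambda>e. cscale (cinner e x) e) has_sum x) B"
  unfolding has_sum_def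
proof (rule tendstoI)
  fix r :: real assume "r > 0"
  have "x \<in> closure (cspan B)" using assms by (simp add: onb_def)
  then obtain s where s: "s \<in> cspan B" "dist s x < r" using \<open>r > 0\<close> closure_approachable by blast
  then obtain S c where S: "finite S" "S \<subseteq> B" "s = (\<Sum>e\<in>S. cscale (c e) e)" by (auto simp: cspan_def)
  have "dist (\<Sum>e\<in>T. cscale (cinner e x) e) x < r" if T: "finite T" "S \<subseteq> T" "T \<subseteq> B" for T
  proof -
    let ?xT = "\<Sum>e\<in>T. cscale (cinner e x) e"
    have orth: "cinner e (x - ?xT) = 0" if "e \<in> T" for e
    proof -
      have "cinner e ?xT = (\<Sum>f\<in>T. if f = e then cinner e x else 0)"
        unfolding cinner_sum_right
        by (rule sum.cong) (use assms T that in \<open>auto simp: onb_def cinner_cscale_right cinner_self subset_iff\<close>)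
      thus ?thesis using T(1) that by (simp add: cinner_diff_right)
    qed
    have "?xT - s = (\<Sum>e\<in>T. cscale (cinner e x - (if e \<in> S then c e else 0)) e)"
    proof -
      have "s = (\<Sum>e\<in>T. cscale (if e \<in> S then c e else 0) e)"
        unfolding S(3) by (rule sum.mono_neutral_cong_left) (use T in auto)
      thus ?thesis by (simp add: sum_subtractf cscale_diff_left)
    qed
    hence "cinner (?xT - s) (x - ?xT) = 0"
      by (simp add: cinner_sum_left cinner_cscale_left orth)
    hence "(norm (?xT - s + (x - ?xT)))\<^sup>2 = (norm (?xT - s))\<^sup>2 + (norm (x - ?xT))\<^sup>2"
      by (simp only: norm_add_sq) simp
    hence "(norm (x - ?xT))\<^sup>2 \<le> (norm (x - s))\<^sup>2" by simp
    hence "norm (x - ?xT) \<le> norm (x - s)" by (rule power2_le_imp_le) simp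
    thus ?thesis using s(2) by (simp add: dist_norm norm_minus_commute)
  qed
  thus "\<forall>\<^sub>F T in finite_subsets_at_top B. dist (\<Sum>e\<in>T. cscale (cinner e x) e) x < r"
    unfolding eventually_finite_subsets_at_top using S by blast
qed

lemma parseval:
  assumes "onb B"
  shows "((\<lambda>e. cinner x e * cinner e y) has_sum cinner x y) B"
  using has_sum_bounded_linear[OF bounded_bilinear.bounded_linear_right[OF bounded_bilinear_cinner]
      onb_expansion[OF assms], of x y]
  by (simp add: cinner_cscale_right mult.commute)

lemma parseval_norm:
  assumes "onb B"
  shows "((\<lambda>e. (cmod (cinner x e))\<^sup>2) has_sum (norm x)\<^sup>2) B"
proof -
  have "cinner x e * cinner e x = complex_of_real ((cmod (cinner x e))\<^sup>2)" for e
    by (simp only: complex_norm_square cinner_conj[of e x])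
  thus ?thesis using has_sum_bounded_linear[OF bounded_linear_Re parseval[OF assms, of x x]]
    by (simp add: cinner_self)
qed

section \<open>Rank one decompositions and the trace\<close>

text \<open>The vector of one Cholesky step in direction \<open>d\<close>. If the form of a positive
  \<open>P\<close> vanishes at \<open>d\<close>, then P d = 0, and division by zero yielding 0 gives
  the right value 0.\<close>

definition deflation_vector :: "('a::chilbert \<Rightarrow> 'a) \<Rightarrow> 'a \<Rightarrow> 'a" where
  "deflation_vector P d = cscale (complex_of_real (1 / sqrt (Re (cinner d (P d))))) (P d)"

definition deflate :: "('a::chilbert \<Rightarrow> 'a) \<Rightarrow> 'a \<Rightarrow> 'a \<Rightarrow> 'a" where
  "deflate P d = (\<lambda>y. P y - cscale (cinner (deflation_vector P d) y) (deflation_vector P d))"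

lemma positive_op_vanishes:
  assumes "positive_op P" "Re (cinner d (P d)) = 0"
  shows "P d = 0"
  using positive_op_cauchy_schwarz[OF assms(1), of "P d" d] assms(2) by (simp add: cinner_self)

text \<open>Cauchy-Schwarz for the form of \<open>P\<close> says that the subtracted square
  \<bar>\<langle>v, y\<rangle>\<bar>^2 is at most \<langle>y, P y\<rangle>, so positivity survives.
  The kernel survives because \<langle>v, y\<rangle> is a multiple of \<langle>d, P
  y\<rangle>.\<close>

lemma
  assumes P: "positive_op P"
  shows positive_op_deflate: "positive_op (deflate P d)"
    and deflate_self: "deflate P d d = 0"
    and deflate_kernel: "P e = 0 \<Longrightarrow> deflate P d e = 0"
proof -
  note b = bopD[OF positive_op_bop[OF P]]
  define c where "c = Re (cinner d (P d))"
  define v where "v = deflation_vector P d"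
  have v: "v = cscale (complex_of_real (1 / sqrt c)) (P d)"
    by (simp add: v_def deflation_vector_def c_def)
  have c0: "0 \<le> c" using P by (simp add: c_def positive_op_def)
  have cc: "cinner d (P d) = complex_of_real c"
    using P by (simp add: c_def positive_op_def complex_eq_iff)
  have vy: "cinner v y = complex_of_real (1 / sqrt c) * cinner d (P y)" for y
    by (simp add: v cinner_cscale_left positive_op_hermitian[OF P])
  have form: "cinner y (deflate P d y) = cinner y (P y) - complex_of_real ((cmod (cinner v y))\<^sup>2)" for y
    by (simp only: deflate_def v_def[symmetric] cinner_diff_right cinner_cscale_right
        complex_norm_square cinner_conj[of y v])
  have le: "(cmod (cinner v y))\<^sup>2 \<le> Re (cinner y (P y))" for y
  proof (cases "c = 0")
    case True
    thus ?thesis using P by (simp add: vy positive_op_def)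
  next
    case False
    have "(cmod (cinner v y))\<^sup>2 = (cmod (cinner d (P y)))\<^sup>2 / c"
      using c0 by (simp add: vy norm_mult norm_divide power_divide)
    also have "\<dots> \<le> (c * Re (cinner y (P y))) / c"
      using positive_op_cauchy_schwarz[OF P, of d y] c0 by (intro divide_right_mono) (auto simp: c_def)
    finally show ?thesis using False by simp
  qed
  obtain K where K: "K > 0" "\<And>x. norm (P x) \<le> K * norm x"
    using bop_bound[OF positive_op_bop[OF P]] by metis
  have "bop (deflate P d)"
  proof (rule bopI[where K = "K + norm v * norm v"])
    fix y
    have "norm (deflate P d y) \<le> norm (P y) + cmod (cinner v y) * norm v"
      unfolding deflate_def v_def[symmetric] by (metis norm_triangle_ineq4 norm_cscale)
    also have "\<dots> \<le> K * norm y + norm v * norm y * norm v"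
      by (intro add_mono K(2) mult_right_mono cmod_cinner_le) auto
    finally show "norm (deflate P d y) \<le> (K + norm v * norm v) * norm y" by (simp add: algebra_simps)
  qed (simp_all add: deflate_def b cinner_add_right cinner_cscale_right cscale_add_left
      cscale_diff_right cscale_cscale)
  thus "positive_op (deflate P d)"
    using P le by (simp add: positive_op_def form)
  show "deflate P d d = 0"
  proof (cases "c = 0")
    case True
    hence "P d = 0" by (intro positive_op_vanishes[OF P]) (simp add: c_def)
    thus ?thesis by (simp add: deflate_def deflation_vector_def)
  next
    case False
    have "cscale (cinner v d) v = cscale (cinner v d * complex_of_real (1 / sqrt c)) (P d)"
      by (metis v cscale_cscale)
    also have "cinner v d * complex_of_real (1 / sqrt c) = complex_of_real (c / (sqrt c * sqrt c))"
      by (simp add: vy cc del: real_sqrt_mult_self)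
    finally show ?thesis using False c0 by (simp add: deflate_def v_def[symmetric] cscale_one)
  qed
  show "deflate P d e = 0" if "P e = 0"
    using that by (simp add: deflate_def v_def[symmetric] vy)
qed

lemma separable_dense_sequence:
  assumes "separable (UNIV :: 'a::chilbert set)"
  obtains d :: "nat \<Rightarrow> 'a::chilbert" where "\<And>x r. r > 0 \<Longrightarrow> \<exists>k. norm (x - d k) < r"
proof -
  obtain D :: "'a set" where D: "countable D" "closure D = UNIV"
    using assms by (auto simp: separable_def)
  hence ne: "D \<noteq> {}" by auto
  have "\<exists>k. norm (x - from_nat_into D k) < r" if "r > 0" for x r
  proof -
    obtain y where "y \<in> D" "dist y x < r"
      using D(2) \<open>r > 0\<close> closure_approachable[of x D] by blast
    thus ?thesis using from_nat_into_surj[OF D(1)] by (metis dist_norm norm_minus_commute)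
  qed
  thus ?thesis by (rule that)
qed

text \<open>The residual \<open>Q k\<close> is positive, its quadratic form is dominated by that of
  \<open>P\<close>, and it annihilates \<open>d j\<close> for all j < k. Density of the sequence
  \<open>d\<close> then drives its form to 0 at every vector.\<close>

lemma rank_one_decomposition:
  fixes P :: "'a::chilbert \<Rightarrow> 'a"
  assumes "separable (UNIV :: 'a set)" and P: "positive_op P"
  shows "\<exists>v. \<forall>x y. (\<lambda>m::nat. cinner x (v m) * cinner (v m) y) sums cinner x (P y)"
proof -
  obtain d :: "nat \<Rightarrow> 'a" where d: "\<And>x r. r > 0 \<Longrightarrow> \<exists>k. norm (x - d k) < r"
    using separable_dense_sequence[OF assms(1)] by metis
  define Q where "Q = rec_nat P (\<lambda>k R. deflate R (d k))"
  have Q0: "Q 0 = P" and QS: "Q (Suc k) = deflate (Q k) (d k)" for k by (simp_all add: Q_def)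
  define v where "v k = deflation_vector (Q k) (d k)" for k
  have pos: "positive_op (Q k)" for k
    by (induction k) (simp_all add: Q0 QS P positive_op_deflate)
  have step: "Q (Suc k) y = Q k y - cscale (cinner (v k) y) (v k)" for k y
    by (simp add: QS v_def deflate_def)
  have kernel: "Q k (d j) = 0" if "j < k" for j k
    using that
  proof (induction k)
    case (Suc k)
    show ?case
    proof (cases "j = k")
      case True thus ?thesis by (simp add: QS deflate_self pos)
    next
      case False thus ?thesis using Suc by (simp add: QS deflate_kernel pos)
    qed
  qed simp
  have partial: "(\<Sum>m<k. cinner x (v m) * cinner (v m) y) = cinner x (P y) - cinner x (Q k y)" for k x y
    by (induction k) (simp_all add: Q0 step cinner_diff_right cinner_cscale_right mult.commute)
  have mono: "Re (cinner x (Q k x)) \<le> Re (cinner x (P x))" for k x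
  proof -
    have "cinner x (v m) * cinner (v m) x = complex_of_real ((cmod (cinner x (v m)))\<^sup>2)" for m
      by (simp only: complex_norm_square cinner_conj[of "v m" x])
    hence "Re (\<Sum>m<k. cinner x (v m) * cinner (v m) x) \<ge> 0" by (auto intro!: sum_nonneg)
    thus ?thesis by (simp add: partial)
  qed
  obtain K where K: "K > 0" "\<And>x. norm (P x) \<le> K * norm x"
    using bop_bound[OF positive_op_bop[OF P]] by metis
  have Pbd: "Re (cinner x (P x)) \<le> K * (norm x)\<^sup>2" for x
    using order_trans[OF complex_Re_le_cmod order_trans[OF cmod_cinner_le mult_left_mono[OF K(2) norm_ge_zero]]]
    by (simp add: power2_eq_square mult_ac)
  have lim: "(\<lambda>k. Re (cinner y (Q k y))) \<longlonglongrightarrow> 0" for y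
  proof (rule LIMSEQ_I)
    fix r :: real assume r: "0 < r"
    \<comment> \<open>The radius is chosen so that \<open>K\<close> times its square is
      \<open>r\<close>.\<close>
    obtain j where j: "norm (y - d j) < sqrt (r / K)" using d[of "sqrt (r / K)" y] r K(1) by auto
    have "norm (Re (cinner y (Q k y)) - 0) < r" if "k \<ge> Suc j" for k
    proof -
      have z: "Q k (d j) = 0" using that by (simp add: kernel)
      \<comment> \<open>Since \<open>d j\<close> is in the kernel of the hermitian
        \<open>Q k\<close>, it may be subtracted in both arguments.\<close>
      have "cinner y (Q k y) = cinner (y - d j) (Q k (y - d j))"
        using positive_op_hermitian[OF pos, of "d j" k y] z
        by (simp add: bopD[OF positive_op_bop[OF pos]] cinner_diff_left)
      also have "Re \<dots> \<le> K * (norm (y - d j))\<^sup>2" by (rule order_trans[OF mono Pbd])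
      also have "\<dots> < r"
        using power_strict_mono[OF j norm_ge_zero, of 2] r K(1) by (simp add: field_simps)
      finally show ?thesis using pos[of k] by (simp add: positive_op_def)
    qed
    thus "\<exists>no. \<forall>n\<ge>no. norm (Re (cinner y (Q n y)) - 0) < r" by blast
  qed
  \<comment> \<open>Cauchy-Schwarz for \<open>Q k\<close> carries the decay from the diagonal to all
    pairs.\<close>
  have "(\<lambda>k. cinner x (Q k y)) \<longlonglongrightarrow> 0" for x y
  proof (rule Lim_null_comparison)
    have "cmod (cinner x (Q k y)) \<le> sqrt (Re (cinner x (Q k x)) * Re (cinner y (Q k y)))" for k
      using positive_op_cauchy_schwarz[OF pos] by (simp add: real_le_rsqrt)
    thus "\<forall>\<^sub>F k in sequentially. cmod (cinner x (Q k y)) \<le> sqrt (Re (cinner x (Q k x)) * Re (cinner y (Q k y)))"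
      by simp
    show "(\<lambda>k. sqrt (Re (cinner x (Q k x)) * Re (cinner y (Q k y)))) \<longlonglongrightarrow> 0"
      using tendsto_real_sqrt[OF tendsto_mult[OF lim[of x] lim[of y]]] by simp
  qed
  hence "(\<lambda>k. \<Sum>m<k. cinner x (v m) * cinner (v m) y) \<longlonglongrightarrow> cinner x (P y)" for x y
    unfolding partial using tendsto_diff[OF tendsto_const] by fastforce
  thus ?thesis unfolding sums_def by blast
qed

text \<open>The vectors \<open>v m\<close> need not be orthogonal. By Parseval, a partial sum of
  their squared norms is a sum over the basis of partial sums of the series for \<langle>e, \<rho>
  e\<rangle>, hence at most the trace 1.\<close>

lemma density_decomposition:
  fixes \<rho> :: "'a::chilbert \<Rightarrow> 'a"
  assumes "separable (UNIV :: 'a set)" and "density \<rho>"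
  obtains v :: "nat \<Rightarrow> 'a" where "\<And>x y. (\<lambda>m. cinner x (v m) * cinner (v m) y) sums cinner x (\<rho> y)"
    and "summable (\<lambda>m. (norm (v m))\<^sup>2)"
proof -
  obtain v :: "nat \<Rightarrow> 'a" where v: "\<And>x y. (\<lambda>m. cinner x (v m) * cinner (v m) y) sums cinner x (\<rho> y)"
    using rank_one_decomposition[of \<rho>] assms by (auto simp: density_def)
  obtain B where B: "onb B" "((\<lambda>e. Re (cinner e (\<rho> e))) has_sum 1) B"
    using assms(2) by (auto simp: density_def)
  have "(\<Sum>m<n. (norm (v m))\<^sup>2) \<le> 1" for n
  proof (rule has_sum_mono)
    show "((\<lambda>e. \<Sum>m<n. (cmod (cinner (v m) e))\<^sup>2) has_sum (\<Sum>m<n. (norm (v m))\<^sup>2)) B"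
      by (induction n) (simp_all add: has_sum_add parseval_norm B)
    fix e
    have "cinner e (v m) * cinner (v m) e = complex_of_real ((cmod (cinner (v m) e))\<^sup>2)" for m
      by (simp only: complex_norm_square cinner_conj[of e "v m"] mult.commute)
    hence "(\<lambda>m. (cmod (cinner (v m) e))\<^sup>2) sums Re (cinner e (\<rho> e))"
      using sums_Re[OF v[of e e]] by simp
    thus "(\<Sum>m<n. (cmod (cinner (v m) e))\<^sup>2) \<le> Re (cinner e (\<rho> e))"
      using sum_le_suminf[of "\<lambda>m. (cmod (cinner (v m) e))\<^sup>2" "{..<n}"] by (simp add: sums_iff)
  qed (rule B)
  hence "summable (\<lambda>m. (norm (v m))\<^sup>2)" by (intro summableI_nonneg_bounded) auto
  thus ?thesis using that v by blast
qed

text \<open>A double series over \<open>m\<close> and the basis is summed in both orders: the basis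
  first gives \<langle>v m, B (v m)\<rangle> by Parseval, \<open>m\<close> first gives the diagonal
  entries of \<rho> B. The left side does not mention the basis, so the one selected inside
  \<open>trace\<close> is irrelevant.\<close>

lemma trace_comp_sums:
  fixes v :: "nat \<Rightarrow> 'a::chilbert"
  assumes v: "\<And>x y. (\<lambda>m. cinner x (v m) * cinner (v m) y) sums cinner x (\<rho> y)"
    and sv: "summable (\<lambda>m. (norm (v m))\<^sup>2)" and "bop B"
  shows "(\<lambda>m. cinner (v m) (B (v m))) sums trace (\<rho> \<circ> B)"
proof -
  define E where "E = (SOME E :: 'a set. onb E)"
  have E: "onb E" unfolding E_def using onb_exists by (rule someI_ex)
  obtain C where C: "bop C" "\<And>x y. cinner (C x) y = cinner x (B y)"
    using hilbert_adjoint_exists[OF \<open>bop B\<close>] by blast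
  obtain K where K: "K > 0" "\<And>x. norm (C x) \<le> K * norm x" using bop_bound[OF C(1)] by metis
  define h where "h = (\<lambda>(m, e). cinner e (v m) * cinner (v m) (B e))"
  \<comment> \<open>The majorant that justifies the exchange: 2ab \<le> a^2 + b^2 after
    \<open>B\<close> is moved to the other side as its adjoint \<open>C\<close>. Parseval sums each
    square over the basis.\<close>
  define g where "g = (\<lambda>(m, e). (cmod (cinner (v m) e))\<^sup>2 + (cmod (cinner (C (v m)) e))\<^sup>2)"
  have sg: "g summable_on (UNIV \<times> E)"
  proof (rule summable_on_SigmaI)
    show "((\<lambda>e. g (m, e)) has_sum ((norm (v m))\<^sup>2 + (norm (C (v m)))\<^sup>2)) E" for m
      unfolding g_def by (simp add: has_sum_add parseval_norm E)
    have "(norm (C (v m)))\<^sup>2 \<le> K\<^sup>2 * (norm (v m))\<^sup>2" for m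
      using power_mono[OF K(2)[of "v m"], of 2] by (simp add: power_mult_distrib)
    hence "summable (\<lambda>m. (norm (v m))\<^sup>2 + (norm (C (v m)))\<^sup>2)"
      by (intro summable_add sv summable_comparison_test'[OF summable_mult[OF sv, of "K\<^sup>2"]]) auto
    thus "(\<lambda>m. (norm (v m))\<^sup>2 + (norm (C (v m)))\<^sup>2) summable_on UNIV"
      by (subst summable_on_UNIV_nonneg_real_iff) auto
  qed (auto simp: g_def)
  have hg: "norm (h p) \<le> g p" for p
  proof -
    obtain m e where p: "p = (m, e)" by (cases p)
    have "2 * (a * b) \<le> a\<^sup>2 + b\<^sup>2" for a b :: real
      using zero_le_power2[of "a - b"] by (simp add: power2_diff)
    hence "cmod (cinner (v m) e) * cmod (cinner (C (v m)) e) \<le> g p"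
      using mult_nonneg_nonneg[OF norm_ge_zero norm_ge_zero, of "cinner (v m) e" "cinner (C (v m)) e"]
      unfolding g_def p by (simp, smt (verit))
    moreover have "cmod (cinner e (v m)) = cmod (cinner (v m) e)"
      by (metis cinner_conj complex_mod_cnj)
    ultimately show ?thesis by (simp add: h_def p norm_mult C(2))
  qed
  have "h summable_on (UNIV \<times> E)"
    by (rule Infinite_Sum.abs_summable_summable,
        rule Infinite_Sum.abs_summable_on_comparison_test'[OF sg hg])
  then obtain S where S: "(h has_sum S) (UNIV \<times> E)" by (auto simp: summable_on_def)
  have "((\<lambda>m. cinner (v m) (B (v m))) has_sum S) UNIV"
  proof (rule has_sum_SigmaD[OF S])
    show "((\<lambda>e. h (m, e)) has_sum cinner (v m) (B (v m))) E" for m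
      using parseval[OF E, of "C (v m)" "v m"] by (simp add: h_def C(2) mult.commute)
  qed
  hence 1: "(\<lambda>m. cinner (v m) (B (v m))) sums S" by (rule has_sum_imp_sums)
  have S': "((\<lambda>(e, m). h (m, e)) has_sum S) (E \<times> UNIV)" using iffD1[OF has_sum_swap S] .
  have "((\<lambda>e. cinner e ((\<rho> \<circ> B) e)) has_sum S) E"
  proof (rule has_sum_SigmaD[OF S'])
    fix e assume "e \<in> E"
    hence "(\<lambda>m. h (m, e)) summable_on UNIV"
      using summable_on_SigmaD1[of "\<lambda>e m. h (m, e)" E "\<lambda>_. UNIV" e] S' by (auto simp: summable_on_def)
    then obtain L where L: "((\<lambda>m. h (m, e)) has_sum L) UNIV" by (auto simp: summable_on_def)
    moreover have "(\<lambda>m. h (m, e)) sums cinner e ((\<rho> \<circ> B) e)" using v[of e "B e"] by (simp add: h_def)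
    ultimately show "((\<lambda>m. case (e, m) of (e, m) \<Rightarrow> h (m, e)) has_sum cinner e ((\<rho> \<circ> B) e)) UNIV"
      using has_sum_imp_sums[OF L] sums_unique2 by fastforce
  qed
  hence "trace (\<rho> \<circ> B) = S" unfolding trace_def E_def[symmetric] by (rule infsumI)
  thus ?thesis using 1 by simp
qed

section \<open>Operators on tensor products\<close>

text \<open>\<open>cspan\<close> indexes combinations by vectors. Later kernels are indexed by
  parameters of a map \<open>t\<close> that need not be injective, so one preimage is chosen for
  each vector.\<close>

lemma cspan_range:
  assumes "x \<in> cspan (range t)"
  obtains I c where "finite I" "x = (\<Sum>i\<in>I. cscale (c i) (t i))"
proof -
  obtain T c where T: "finite T" "T \<subseteq> range t" "x = (\<Sum>z\<in>T. cscale (c z) z)"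
    using assms by (auto simp: cspan_def)
  obtain I where I: "inj_on t I" "T = t ` I" using T(2) by (auto simp: subset_image_inj)
  have "finite I" using T(1) I finite_image_iff by blast
  moreover have "x = (\<Sum>i\<in>I. cscale (c (t i)) (t i))" unfolding T(3) I(2) by (simp add: sum.reindex I(1))
  ultimately show ?thesis by (rule that)
qed

text \<open>The bound makes the assignment of \<open>s i\<close> to \<open>t i\<close> well defined
  on the span and uniformly continuous. Working with graphs instead of functions turns
  well-definedness into one consequence of the bound.\<close>

lemma bop_extension:
  fixes t :: "'i \<Rightarrow> 'c::chilbert" and s :: "'i \<Rightarrow> 'd::chilbert"
  assumes dense: "closure (cspan (range t)) = UNIV"
    and bound: "\<And>T c. finite T \<Longrightarrow>
      norm (\<Sum>i\<in>T. cscale (c i) (s i)) \<le> K * norm (\<Sum>i\<in>T. cscale (c i) (t i))"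
  shows "\<exists>Y. bop Y \<and> (\<forall>i. Y (t i) = s i)"
proof -
  define R where "R x y \<longleftrightarrow> (\<exists>T c. finite T \<and> x = (\<Sum>i\<in>T. cscale (c i) (t i)) \<and>
    y = (\<Sum>i\<in>T. cscale (c i) (s i)))" for x y
  have R_add: "R (x + x') (y + y')" if xy: "R x y" and xy': "R x' y'" for x x' y y'
  proof -
    obtain T c where T: "finite T" "x = (\<Sum>i\<in>T. cscale (c i) (t i))" "y = (\<Sum>i\<in>T. cscale (c i) (s i))"
      using xy by (auto simp: R_def)
    obtain T' c' where T': "finite T'" "x' = (\<Sum>i\<in>T'. cscale (c' i) (t i))" "y' = (\<Sum>i\<in>T'. cscale (c' i) (s i))"
      using xy' by (auto simp: R_def)
    let ?c = "\<lambda>i. if i \<in> T then c i else 0" and ?c' = "\<lambda>i. if i \<in> T' then c' i else 0"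
    have "x = (\<Sum>i\<in>T \<union> T'. cscale (?c i) (t i))" "y = (\<Sum>i\<in>T \<union> T'. cscale (?c i) (s i))"
      unfolding T(2,3) by (rule sum.mono_neutral_cong_left; use T T' in auto)+
    moreover have "x' = (\<Sum>i\<in>T \<union> T'. cscale (?c' i) (t i))" "y' = (\<Sum>i\<in>T \<union> T'. cscale (?c' i) (s i))"
      unfolding T'(2,3) by (rule sum.mono_neutral_cong_left; use T T' in auto)+
    ultimately show ?thesis unfolding R_def using T(1) T'(1)
      by (intro exI[of _ "T \<union> T'"] exI[of _ "\<lambda>i. ?c i + ?c' i"])
        (simp add: cscale_add_left sum.distrib)
  qed
  have R_scale: "R (cscale a x) (cscale a y)" if xy: "R x y" for a x y
  proof -
    obtain T c where "finite T" "x = (\<Sum>i\<in>T. cscale (c i) (t i))" "y = (\<Sum>i\<in>T. cscale (c i) (s i))"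
      using xy by (auto simp: R_def)
    thus ?thesis unfolding R_def
      by (intro exI[of _ T] exI[of _ "\<lambda>i. a * c i"]) (simp add: cscale_sum_right cscale_cscale)
  qed
  have R_base: "R (t i) (s i)" for i
    unfolding R_def by (intro exI[of _ "{i}"] exI[of _ "\<lambda>_. 1"]) (simp add: cscale_one)
  have R_norm: "norm y \<le> K * norm x" if "R x y" for x y
    using that bound by (auto simp: R_def)
  have R_total: "\<exists>y. R x y" if x: "x \<in> cspan (range t)" for x
  proof -
    obtain I c where "finite I" "x = (\<Sum>i\<in>I. cscale (c i) (t i))" using x by (rule cspan_range)
    thus ?thesis unfolding R_def by (intro exI[of _ "\<Sum>i\<in>I. cscale (c i) (s i)"] exI[of _ I] exI[of _ c]) simp
  qed
  \<comment> \<open>\<open>L\<close> is the closure of the graph \<open>R\<close>. It is linear and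
    obeys the same bound, so it is single valued; completeness makes it total.\<close>
  define L where "L x y \<longleftrightarrow> (\<exists>xs ys. (\<forall>n. R (xs n) (ys n)) \<and> xs \<longlonglongrightarrow> x \<and> ys \<longlonglongrightarrow> y)" for x y
  have L_add: "L (x + x') (y + y')" if xy: "L x y" and xy': "L x' y'" for x x' y y'
  proof -
    obtain xs ys where "\<And>n. R (xs n) (ys n)" "xs \<longlonglongrightarrow> x" "ys \<longlonglongrightarrow> y" using xy by (auto simp: L_def)
    moreover obtain xs' ys' where "\<And>n. R (xs' n) (ys' n)" "xs' \<longlonglongrightarrow> x'" "ys' \<longlonglongrightarrow> y'"
      using xy' by (auto simp: L_def)
    ultimately show ?thesis unfolding L_def
      by (intro exI[of _ "\<lambda>n. xs n + xs' n"] exI[of _ "\<lambda>n. ys n + ys' n"])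
        (auto intro: R_add tendsto_add)
  qed
  have L_scale: "L (cscale a x) (cscale a y)" if xy: "L x y" for a x y
  proof -
    obtain xs ys where "\<And>n. R (xs n) (ys n)" "xs \<longlonglongrightarrow> x" "ys \<longlonglongrightarrow> y" using xy by (auto simp: L_def)
    thus ?thesis unfolding L_def
      by (intro exI[of _ "\<lambda>n. cscale a (xs n)"] exI[of _ "\<lambda>n. cscale a (ys n)"])
        (auto intro: R_scale tendsto_cscale[OF tendsto_const])
  qed
  have L_norm: "norm y \<le> K * norm x" if xy: "L x y" for x y
  proof -
    obtain xs ys where "\<And>n. R (xs n) (ys n)" "xs \<longlonglongrightarrow> x" "ys \<longlonglongrightarrow> y" using xy by (auto simp: L_def)
    thus ?thesis
      by (intro LIMSEQ_le[OF tendsto_norm[of ys] tendsto_mult[OF tendsto_const tendsto_norm[of xs]]])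
        (auto intro: R_norm)
  qed
  have L_unique: "y = y'" if "L x y" "L x y'" for x y y'
  proof -
    have "L (x + cscale (-1) x) (y + cscale (-1) y')" using that by (intro L_add L_scale)
    from L_norm[OF this] show ?thesis by (simp add: cscale_minus_one)
  qed
  have L_total: "\<exists>y. L x y" for x
  proof -
    obtain xs where xs: "\<And>n. xs n \<in> cspan (range t)" "xs \<longlonglongrightarrow> x"
      using dense closure_sequential[of x "cspan (range t)"] by auto
    obtain ys where ys: "\<And>n. R (xs n) (ys n)" using R_total[OF xs(1)] by metis
    have "Cauchy ys"
    proof (rule CauchyI)
      fix e :: real assume e: "0 < e"
      have "Cauchy xs" using xs(2) by (rule LIMSEQ_imp_Cauchy)
      then obtain M where M: "\<And>m n. m \<ge> M \<Longrightarrow> n \<ge> M \<Longrightarrow> norm (xs m - xs n) < e / (\<bar>K\<bar> + 1)"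
        using e by (force simp: Cauchy_iff)
      have "norm (ys m - ys n) < e" if "m \<ge> M" "n \<ge> M" for m n
      proof -
        have "R (xs m + cscale (-1) (xs n)) (ys m + cscale (-1) (ys n))" using ys by (intro R_add R_scale)
        hence "norm (ys m - ys n) \<le> K * norm (xs m - xs n)" using R_norm by (fastforce simp: cscale_minus_one)
        also have "\<dots> \<le> (\<bar>K\<bar> + 1) * norm (xs m - xs n)" by (intro mult_right_mono) auto
        also have "\<dots> < e" using M[OF that] by (simp add: field_simps)
        finally show ?thesis .
      qed
      thus "\<exists>M. \<forall>m\<ge>M. \<forall>n\<ge>M. norm (ys m - ys n) < e" by blast
    qed
    then obtain y where "ys \<longlonglongrightarrow> y" by (auto simp: Cauchy_convergent_iff convergent_def)
    thus ?thesis using xs ys by (auto simp: L_def)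
  qed
  obtain Y where Y: "\<And>x. L x (Y x)" using L_total by metis
  have "bop Y"
    using L_unique[OF Y L_add[OF Y Y]] L_unique[OF Y L_scale[OF Y]] L_norm[OF Y]
    by (rule bopI)
  moreover have "L (t i) (s i)" for i
    unfolding L_def by (intro exI[of _ "\<lambda>_. t i"] exI[of _ "\<lambda>_. s i"]) (simp add: R_base)
  hence "Y (t i) = s i" for i by (rule L_unique[OF Y])
  ultimately show ?thesis by blast
qed

text \<open>The optimal weight satisfies r^2 = b/a. Adding \<open>e\<close> to both quantities
  avoids the degenerate cases a = 0 and b = 0, and \<open>e\<close> then tends to 0.\<close>

lemma am_gm_homogenize:
  fixes a b K X :: real
  assumes "0 \<le> a" "0 \<le> b" "0 \<le> K" and le: "\<And>r. r > 0 \<Longrightarrow> X \<le> K * ((r * a)\<^sup>2 + (b / r)\<^sup>2)"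
  shows "X \<le> 2 * K * a * b"
proof -
  have pos: "X \<le> 2 * K * (a + e) * (b + e)" if "e > 0" for e
  proof -
    define r where "r = sqrt ((b + e) / (a + e))"
    have r2: "r\<^sup>2 = (b + e) / (a + e)" and r0: "r > 0" using assms(1,2) that by (auto simp: r_def)
    have "X \<le> K * ((r * a)\<^sup>2 + (b / r)\<^sup>2)" by (rule le[OF r0])
    also have "\<dots> \<le> K * ((r * (a + e))\<^sup>2 + ((b + e) / r)\<^sup>2)"
      using assms(1,2,3) that r0
      by (intro mult_left_mono add_mono power_mono mult_left_mono divide_right_mono) auto
    also have "(r * (a + e))\<^sup>2 = (a + e) * (b + e)"
      using assms(1) that by (simp only: power_mult_distrib r2) (simp add: power2_eq_square)
    also have "((b + e) / r)\<^sup>2 = (a + e) * (b + e)"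
      using assms(2) that by (simp only: power_divide r2) (simp add: power2_eq_square)
    also have "K * ((a + e) * (b + e) + (a + e) * (b + e)) = 2 * K * (a + e) * (b + e)" by simp
    finally show ?thesis .
  qed
  have "(\<lambda>n. 2 * K * (a + inverse (real (Suc n))) * (b + inverse (real (Suc n)))) \<longlonglongrightarrow> 2 * K * (a + 0) * (b + 0)"
    by (intro tendsto_intros LIMSEQ_inverse_real_of_nat)
  from LIMSEQ_le_const[OF this, of X] show ?thesis using pos by auto
qed

text \<open>The bound is stated in arithmetic-mean form because that is what survives summation over
  rank-one pieces; rescaling \<open>c\<close> and \<open>d\<close> turns it into a genuine product bound.\<close>

lemma bop_from_kernel:
  fixes t :: "'i \<Rightarrow> 'c::chilbert" and k :: "'i \<Rightarrow> 'i \<Rightarrow> complex"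
  assumes dense: "closure (cspan (range t)) = UNIV" and "0 \<le> K"
    and bound: "\<And>T c d. finite T \<Longrightarrow> cmod (\<Sum>i\<in>T. \<Sum>j\<in>T. cnj (c i) * d j * k i j)
      \<le> K * ((norm (\<Sum>i\<in>T. cscale (c i) (t i)))\<^sup>2 + (norm (\<Sum>i\<in>T. cscale (d i) (t i)))\<^sup>2)"
  shows "\<exists>Y. bop Y \<and> (\<forall>i j. cinner (t i) (Y (t j)) = k i j)"
proof -
  define w where "w T c = (\<Sum>i\<in>T. cscale (c i) (t i))" for T c
  define q where "q T c d = (\<Sum>i\<in>T. \<Sum>j\<in>T. cnj (c i) * d j * k i j)" for T c d
  have qw: "cmod (q T c d) \<le> 2 * K * norm (w T c) * norm (w T d)" if T: "finite T" for T c d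
  proof (rule am_gm_homogenize)
    fix r :: real assume r: "r > 0"
    have sc: "w T (\<lambda>i. a * c i) = cscale a (w T c)" for a c
      by (simp add: w_def cscale_sum_right cscale_cscale)
    \<comment> \<open>The weights r and 1/r cancel in the sesquilinear form but not in the two
      norms, which provides the freedom to optimise.\<close>
    have "q T (\<lambda>i. complex_of_real r * c i) (\<lambda>i. complex_of_real (1 / r) * d i) = q T c d"
      unfolding q_def using r by (intro sum.cong refl) simp
    thus "cmod (q T c d) \<le> K * ((r * norm (w T c))\<^sup>2 + (norm (w T d) / r)\<^sup>2)"
      using bound[OF T, of "\<lambda>i. complex_of_real r * c i" "\<lambda>i. complex_of_real (1 / r) * d i"] r
      unfolding q_def[symmetric] w_def[symmetric] sc by (simp add: norm_divide)
  qed (use \<open>0 \<le> K\<close> in auto)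
  have w_mono: "w T c = w S (\<lambda>i. if i \<in> T then c i else 0)" if "finite S" "T \<subseteq> S" for S T c
    unfolding w_def by (rule sum.mono_neutral_cong_left) (use that in auto)
  \<comment> \<open>Column j of the kernel defines a bounded functional, represented by a vector
    \<open>y\<close>. Its bound is that of \<open>q\<close> with the indicator of j as second
    coefficient family.\<close>
  have "\<exists>y. \<forall>i. cinner (t i) y = k i j" for j
  proof -
    have "\<exists>f :: 'c \<Rightarrow> complex. bop f \<and> (\<forall>i. f (t i) = cnj (k i j))"
    proof (rule bop_extension[OF dense, where K = "2 * K * norm (t j)"])
      fix T :: "'i set" and c :: "'i \<Rightarrow> complex" assume T: "finite T"
      let ?S = "insert j T" and ?c = "\<lambda>i. if i \<in> T then c i else 0" and ?d = "\<lambda>i. if i = j then 1 else 0"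
      have "q ?S ?c ?d = (\<Sum>i\<in>?S. cnj (?c i) * k i j)"
        unfolding q_def
      proof (rule sum.cong[OF refl])
        fix i
        have "(\<Sum>l\<in>?S. cnj (?c i) * ?d l * k i l) = (\<Sum>l\<in>{j}. cnj (?c i) * ?d l * k i l)"
          by (rule sum.mono_neutral_right) (use T in auto)
        thus "(\<Sum>l\<in>?S. cnj (?c i) * ?d l * k i l) = cnj (?c i) * k i j" by simp
      qed
      also have "\<dots> = (\<Sum>i\<in>T. cnj (c i) * k i j)"
        by (rule sum.mono_neutral_cong_right) (use T in auto)
      also have "\<dots> = cnj (\<Sum>i\<in>T. cscale (c i) (cnj (k i j)))" by (simp add: cscale_complex_def)
      finally have "cmod (\<Sum>i\<in>T. cscale (c i) (cnj (k i j))) = cmod (q ?S ?c ?d)"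
        by (simp only: complex_mod_cnj)
      also have "\<dots> \<le> 2 * K * norm (w ?S ?c) * norm (w ?S ?d)" using T by (intro qw) simp
      also have "w ?S ?d = w {j} (\<lambda>_. 1)" using T by (subst w_mono[of ?S "{j}"]) (auto intro: arg_cong)
      also have "w ?S ?c = w T c" using T by (intro w_mono[symmetric]) auto
      finally show "norm (\<Sum>i\<in>T. cscale (c i) (cnj (k i j)))
          \<le> 2 * K * norm (t j) * norm (\<Sum>i\<in>T. cscale (c i) (t i))"
        by (simp add: w_def cscale_one mult_ac)
    qed
    then obtain f :: "'c \<Rightarrow> complex" where f: "bop f" "\<And>i. f (t i) = cnj (k i j)" by blast
    obtain y where "\<And>x. f x = cinner y x" using riesz_representation[OF f(1)] by blast
    hence "cinner (t i) y = k i j" for i using f(2)[of i] cinner_conj[of "t i" y] by simp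
    thus ?thesis by blast
  qed
  then obtain y where y: "\<And>i j. cinner (t i) (y j) = k i j" by metis
  have "\<exists>Y. bop Y \<and> (\<forall>j. Y (t j) = y j)"
  proof (rule bop_extension[OF dense, where K = "2 * K"])
    fix T :: "'i set" and d :: "'i \<Rightarrow> complex" assume T: "finite T"
    define z where "z = (\<Sum>j\<in>T. cscale (d j) (y j))"
    \<comment> \<open>The estimate is proved on the span, extends to the whole space by closedness,
      and is then tested at \<open>z\<close> itself to bound its norm.\<close>
    have "cspan (range t) \<subseteq> {x. cmod (cinner x z) \<le> 2 * K * norm x * norm (w T d)}"
    proof
      fix x assume "x \<in> cspan (range t)"
      then obtain I c where I: "finite I" "x = w I c" unfolding w_def by (rule cspan_range)
      let ?S = "I \<union> T" and ?c = "\<lambda>i. if i \<in> I then c i else 0" and ?d = "\<lambda>i. if i \<in> T then d i else 0"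
      have x: "x = w ?S ?c" and wd: "w T d = w ?S ?d"
        unfolding I(2) using I(1) T by (intro w_mono; auto)+
      have "z = (\<Sum>j\<in>?S. cscale (?d j) (y j))"
        unfolding z_def by (rule sum.mono_neutral_cong_left) (use I T in auto)
      hence "cinner x z = q ?S ?c ?d"
        unfolding x q_def w_def cinner_sum_left cinner_cscale_left
        by (simp add: cinner_sum_right cinner_cscale_right y sum_distrib_left mult.assoc)
      thus "x \<in> {x. cmod (cinner x z) \<le> 2 * K * norm x * norm (w T d)}"
        using qw[of ?S ?c ?d] I(1) T by (simp add: x[symmetric] wd[symmetric])
    qed
    moreover have "closed {x. cmod (cinner x z) \<le> 2 * K * norm x * norm (w T d)}"
      by (intro closed_Collect_le continuous_intros)
    ultimately have "closure (cspan (range t)) \<subseteq> {x. cmod (cinner x z) \<le> 2 * K * norm x * norm (w T d)}"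
      by (rule closure_minimal)
    hence "cmod (cinner z z) \<le> 2 * K * norm z * norm (w T d)" using dense by auto
    hence "norm z * norm z \<le> norm z * (2 * K * norm (w T d))"
      by (simp add: cinner_self norm_power power2_eq_square norm_mult mult_ac)
    hence "norm z \<le> 2 * K * norm (w T d)"
      using \<open>0 \<le> K\<close> by (cases "norm z = 0") (auto simp: mult_le_cancel_left)
    thus "norm (\<Sum>j\<in>T. cscale (d j) (y j)) \<le> 2 * K * norm (\<Sum>i\<in>T. cscale (d i) (t i))"
      by (simp add: z_def w_def)
  qed
  thus ?thesis using y by metis
qed

section \<open>Tensor products and slicing by a fixed vector\<close>

context
  fixes t :: "'a::chilbert \<Rightarrow> 'b::chilbert \<Rightarrow> 'c::chilbert"
  assumes t: "is_tensor t"
begin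

lemma tensor_simps:
  "t (a + a') b = t a b + t a' b" "t a (b + b') = t a b + t a b'"
  "t (cscale c a) b = cscale c (t a b)" "t a (cscale c b) = cscale c (t a b)"
  "cinner (t a b) (t a' b') = cinner a a' * cinner b b'"
  using t by (auto simp: is_tensor_def)

lemma tensor_dense: "closure (cspan (range (case_prod t))) = UNIV"
  using t by (simp add: is_tensor_def)

lemma norm_tensor: "norm (t a b) = norm a * norm b"
proof -
  have "complex_of_real ((norm (t a b))\<^sup>2) = complex_of_real ((norm a * norm b)\<^sup>2)"
    using tensor_simps(5)[of a b a b] unfolding cinner_self by (simp add: power_mult_distrib)
  hence "(norm (t a b))\<^sup>2 = (norm a * norm b)\<^sup>2" by (simp only: of_real_eq_iff)
  thus ?thesis by (rule power2_eq_imp_eq) auto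
qed

lemma bop_tensor_left: "bop (\<lambda>a. t a b)"
  by (rule bopI[where K = "norm b"]) (simp_all add: tensor_simps norm_tensor)

lemma bop_tensor_right: "bop (t a)"
  by (rule bopI[where K = "norm a"]) (simp_all add: tensor_simps norm_tensor)

lemma tensor_bop_eqI:
  assumes "bop A" "bop B" "\<And>a b. A (t a b) = B (t a b)"
  shows "A = B"
  by (rule bop_eqI_dense[OF assms(1,2) tensor_dense]) (auto simp: assms(3))

text \<open>\<open>V\<close> is the adjoint of the embedding a \<mapsto> a \<otimes> \<phi>:
  contraction of the second factor with \<phi>.\<close>

lemma partial_adjoint:
  obtains V where "bop V" "\<And>w x. cinner (V w) x = cinner w (t x \<phi>)" "\<And>w x. cinner x (V w) = cinner (t x \<phi>) w"
    "\<And>a b. V (t a b) = cscale (cinner \<phi> b) a"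
proof -
  obtain V where V: "bop V" "\<And>w x. cinner (V w) x = cinner w (t x \<phi>)"
    using hilbert_adjoint_exists[OF bop_tensor_left] by blast
  have V': "cinner x (V w) = cinner (t x \<phi>) w" for x w
    by (metis V(2) cinner_conj)
  have "V (t a b) = cscale (cinner \<phi> b) a" for a b
    by (rule cinner_ext) (simp add: V' tensor_simps cinner_cscale_right mult.commute)
  thus ?thesis using V V' that by blast
qed

text \<open>With J the embedding a \<mapsto> a \<otimes> \<phi>, the operator \<rho> \<otimes>
  \<bar>\<phi>\<rangle>\<langle>\<phi>\<bar> is J \<rho> J*. This explicit formula supplies the
  existence that the description in \<open>optens\<close> requires.\<close>

lemma optens_ketbra:
  assumes "bop \<rho>" "bop V" "\<And>a b. V (t a b) = cscale (cinner \<phi> b) a"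
  shows "optens t \<rho> (ketbra \<phi>) = (\<lambda>a. t a \<phi>) \<circ> \<rho> \<circ> V"
  unfolding optens_def
proof (rule the_equality)
  show *: "bop ((\<lambda>a. t a \<phi>) \<circ> \<rho> \<circ> V) \<and> (\<forall>a b. ((\<lambda>a. t a \<phi>) \<circ> \<rho> \<circ> V) (t a b) = t (\<rho> a) (ketbra \<phi> b))"
    using assms by (auto intro!: bop_comp bop_tensor_left simp: ketbra_def tensor_simps bopD[OF assms(1)])
  show "W = (\<lambda>a. t a \<phi>) \<circ> \<rho> \<circ> V" if "bop W \<and> (\<forall>a b. W (t a b) = t (\<rho> a) (ketbra \<phi> b))" for W
    by (rule tensor_bop_eqI) (use * that in auto)
qed

text \<open>If the \<open>v m\<close> decompose \<rho>, the vectors v m \<otimes> \<phi> decompose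
  \<rho> \<otimes> \<bar>\<phi>\<rangle>\<langle>\<phi>\<bar>, and both traces become the same
  series.\<close>

lemma trace_optens:
  assumes "separable (UNIV :: 'a set)" "density \<rho>" "bop \<Lambda>" "bop Gm"
    and Gm: "\<And>x y. cinner x (Gm y) = cinner (t x \<phi>) (\<Lambda> (t y \<phi>))"
  shows "trace (\<rho> \<circ> Gm) = trace (optens t \<rho> (ketbra \<phi>) \<circ> \<Lambda>)"
proof -
  obtain v :: "nat \<Rightarrow> 'a" where v: "\<And>x y. (\<lambda>m. cinner x (v m) * cinner (v m) y) sums cinner x (\<rho> y)"
    "summable (\<lambda>m. (norm (v m))\<^sup>2)"
    using density_decomposition[OF assms(1,2)] by blast
  obtain V where V: "bop V" "\<And>w x. cinner (V w) x = cinner w (t x \<phi>)"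
      "\<And>w x. cinner x (V w) = cinner (t x \<phi>) w" "\<And>a b. V (t a b) = cscale (cinner \<phi> b) a"
    using partial_adjoint by blast
  have "bop \<rho>" using assms(2) by (simp add: density_def positive_op_def)
  hence opt: "optens t \<rho> (ketbra \<phi>) = (\<lambda>a. t a \<phi>) \<circ> \<rho> \<circ> V" using V(1,4) by (rule optens_ketbra)
  have "(\<lambda>m. cinner (t (v m) \<phi>) (\<Lambda> (t (v m) \<phi>))) sums trace (optens t \<rho> (ketbra \<phi>) \<circ> \<Lambda>)"
  proof (rule trace_comp_sums[OF _ _ \<open>bop \<Lambda>\<close>])
    show "(\<lambda>m. cinner x (t (v m) \<phi>) * cinner (t (v m) \<phi>) y) sums cinner x (optens t \<rho> (ketbra \<phi>) y)" for x y
      using v(1)[of "V x" "V y"] by (simp add: opt V(2,3))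
    show "summable (\<lambda>m. (norm (t (v m) \<phi>))\<^sup>2)"
      using summable_mult2[OF v(2), of "(norm \<phi>)\<^sup>2"] by (simp add: norm_tensor power_mult_distrib)
  qed
  moreover have "(\<lambda>m. cinner (v m) (Gm (v m))) sums trace (\<rho> \<circ> Gm)"
    by (rule trace_comp_sums[OF v \<open>bop Gm\<close>])
  ultimately show ?thesis unfolding Gm by (rule sums_unique2[symmetric])
qed

end

section \<open>Pure states and the map \<open>Gamma\<close>\<close>

lemma density_ketbra:
  assumes "norm (\<psi> :: 'a::chilbert) = 1"
  shows "density (ketbra \<psi>)"
proof -
  have q: "cinner x (ketbra \<psi> x) = complex_of_real ((cmod (cinner \<psi> x))\<^sup>2)" for x
    by (simp only: ketbra_def cinner_cscale_right complex_norm_square cinner_conj[of x \<psi>])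
  have "bop (ketbra \<psi>)"
  proof (rule bopI[where K = 1])
    show "norm (ketbra \<psi> x) \<le> 1 * norm x" for x
      using cmod_cinner_le[of \<psi> x] assms by (simp add: ketbra_def)
  qed (simp_all add: ketbra_def cinner_add_right cinner_cscale_right cscale_add_left cscale_cscale)
  hence "positive_op (ketbra \<psi>)" by (simp add: positive_op_def q)
  moreover obtain B :: "'a set" where "onb B" using onb_exists by blast
  hence "((\<lambda>e. Re (cinner e (ketbra \<psi> e))) has_sum 1) B"
    using parseval_norm[of B \<psi>] assms by (simp add: q)
  ultimately show ?thesis using \<open>onb B\<close> by (auto simp: density_def)
qed

lemma trace_ketbra:
  assumes "bop (G :: 'a::chilbert \<Rightarrow> 'a)"
  shows "trace (ketbra \<psi> \<circ> G) = cinner \<psi> (G \<psi>)"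
proof -
  \<comment> \<open>A one-term rank one decomposition, padded with zeros to a sequence.\<close>
  let ?v = "\<lambda>m::nat. if m = 0 then \<psi> else 0"
  have if_0: "(\<lambda>m. cinner x (?v m) * cinner (?v m) y) = (\<lambda>m. if m = 0 then cinner x \<psi> * cinner \<psi> y else 0)"
    "(\<lambda>m. cinner (?v m) (G (?v m))) = (\<lambda>m. if m = 0 then cinner \<psi> (G \<psi>) else 0)" for x y
    by (auto simp: bopD[OF assms])
  have "(\<lambda>m. cinner (?v m) (G (?v m))) sums trace (ketbra \<psi> \<circ> G)"
  proof (rule trace_comp_sums[OF _ _ assms])
    show "(\<lambda>m. cinner x (?v m) * cinner (?v m) y) sums cinner x (ketbra \<psi> y)" for x y
      unfolding if_0 using sums_single[of 0 "\<lambda>_. cinner x \<psi> * cinner \<psi> y"]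
      by (simp add: ketbra_def cinner_cscale_right mult.commute)
    show "summable (\<lambda>m. (norm (?v m))\<^sup>2)" by (rule summable_finite[of "{0}"]) auto
  qed
  thus ?thesis unfolding if_0 using sums_single[of 0 "\<lambda>_. cinner \<psi> (G \<psi>)"] sums_unique2 by blast
qed

text \<open>Pure states already recover the quadratic form. This is the uniqueness behind the
  description in \<open>Gamma\<close>.\<close>

lemma density_trace_eqI:
  assumes "bop (G :: 'a::chilbert \<Rightarrow> 'a)" "bop H" "\<And>\<rho>. density \<rho> \<Longrightarrow> trace (\<rho> \<circ> G) = trace (\<rho> \<circ> H)"
  shows "G = H"
proof (rule bop_eqI_quadratic[OF assms(1,2)])
  fix x :: 'a
  show "cinner x (G x) = cinner x (H x)"
  proof (cases "x = 0")
    case False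
    define \<psi> where "\<psi> = cscale (complex_of_real (1 / norm x)) x"
    have "norm \<psi> = 1" using False by (simp add: \<psi>_def norm_divide)
    hence "cinner \<psi> (G \<psi>) = cinner \<psi> (H \<psi>)"
      using assms(3)[OF density_ketbra] by (simp add: trace_ketbra assms(1,2))
    thus ?thesis using False
      by (simp add: \<psi>_def bopD[OF assms(1)] bopD[OF assms(2)] cinner_cscale_left cinner_cscale_right)
  qed simp
qed

text \<open>The compression J* \<Lambda> J with J a = a \<otimes> \<phi> has the required traces, so
  the description denotes it.\<close>

lemma Gamma_characterization:
  fixes t :: "'a::chilbert \<Rightarrow> 'b::chilbert \<Rightarrow> 'c::chilbert"
  assumes t: "is_tensor t" and sep: "separable (UNIV :: 'a set)" and "bop \<Lambda>"
  shows "bop (Gamma t \<phi> \<Lambda>)" "cinner x (Gamma t \<phi> \<Lambda> y) = cinner (t x \<phi>) (\<Lambda> (t y \<phi>))"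
proof -
  obtain V where V: "bop V" "\<And>w x. cinner x (V w) = cinner (t x \<phi>) w"
    using partial_adjoint[OF t] by metis
  define Gm where "Gm = V \<circ> \<Lambda> \<circ> (\<lambda>a. t a \<phi>)"
  have Gm: "bop Gm" unfolding Gm_def by (intro bop_comp V bop_tensor_left[OF t] assms)
  have form: "cinner x (Gm y) = cinner (t x \<phi>) (\<Lambda> (t y \<phi>))" for x y by (simp add: Gm_def V(2))
  have tr: "trace (\<rho> \<circ> Gm) = trace (optens t \<rho> (ketbra \<phi>) \<circ> \<Lambda>)" if "density \<rho>" for \<rho>
    by (rule trace_optens[OF t sep that \<open>bop \<Lambda>\<close> Gm form])
  have "Gamma t \<phi> \<Lambda> = Gm"
    unfolding Gamma_def
  proof (rule the_equality)
    show "bop Gm \<and> (\<forall>\<rho>. density \<rho> \<longrightarrow> trace (\<rho> \<circ> Gm) = trace (optens t \<rho> (ketbra \<phi>) \<circ> \<Lambda>))"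
      using Gm tr by blast
    show "H = Gm" if "bop H \<and> (\<forall>\<rho>. density \<rho> \<longrightarrow> trace (\<rho> \<circ> H) = trace (optens t \<rho> (ketbra \<phi>) \<circ> \<Lambda>))" for H
      by (rule density_trace_eqI) (use that Gm tr in auto)
  qed
  thus "bop (Gamma t \<phi> \<Lambda>)" "cinner x (Gamma t \<phi> \<Lambda> y) = cinner (t x \<phi>) (\<Lambda> (t y \<phi>))"
    using Gm form by auto
qed

section \<open>Positive operator measures\<close>

lemma tensor_ext:
  assumes "is_tensor t" "\<And>a b. cinner (t a b) x = cinner (t a b) y"
  shows "x = y"
proof -
  have b: "bop (cinner z)" for z :: 'c
    by (rule bopI[where K = "norm z"])
      (simp_all add: cinner_add_right cinner_cscale_right cscale_complex_def cmod_cinner_le)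
  have "cinner x = cinner y"
  proof (rule tensor_bop_eqI[OF assms(1) b b])
    show "cinner x (t u v) = cinner y (t u v)" for u v
      using assms(2)[of u v] by (metis cinner_conj)
  qed
  thus ?thesis by (metis cinner_ext_left)
qed

text \<open>Polarisation in one factor at a time: first with the second factor held equal on both
  sides, then in the second factor. Uniqueness of \<open>yen\<close> rests on this.\<close>

lemma tensor_quadratic_eqI:
  assumes t: "is_tensor t" and "bop Y" "bop Z"
    and eq: "\<And>a b. cinner (t a b) (Y (t a b)) = cinner (t a b) (Z (t a b))"
  shows "Y = Z"
proof (rule tensor_bop_eqI[OF t \<open>bop Y\<close> \<open>bop Z\<close>])
  have left: "cinner (t a b) (Y (t a' b)) = cinner (t a b) (Z (t a' b))" for a a' b
  proof -
    obtain V where V: "bop V" "\<And>w x. cinner x (V w) = cinner (t x b) w"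
      using partial_adjoint[OF t] by metis
    have "V \<circ> Y \<circ> (\<lambda>a. t a b) = V \<circ> Z \<circ> (\<lambda>a. t a b)"
      by (intro bop_eqI_quadratic bop_comp V bop_tensor_left[OF t] assms(2,3)) (simp add: V(2) eq)
    thus ?thesis by (metis V(2) comp_apply)
  qed
  have right: "cinner (t a b) (Y (t a' b')) = cinner (t a b) (Z (t a' b'))" for a a' b b'
  proof -
    obtain W where W: "bop W" "\<And>w x. cinner (W w) x = cinner w (t a x)"
      using hilbert_adjoint_exists[OF bop_tensor_right[OF t]] by blast
    have W': "cinner x (W w) = cinner (t a x) w" for x w by (metis W(2) cinner_conj)
    have "W \<circ> Y \<circ> t a' = W \<circ> Z \<circ> t a'"
      by (intro bop_eqI_quadratic bop_comp W bop_tensor_right[OF t] assms(2,3)) (simp add: W' left)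
    thus ?thesis by (metis W' comp_apply)
  qed
  show "Y (t a b) = Z (t a b)" for a b
    by (rule tensor_ext[OF t right])
qed

text \<open>Writing \<open>P\<close> as a sum of rank one operators turns the double sum into
  \<open>\<Sum>m. \<langle>z m, A (z' m)\<rangle>\<close>: this replaces the Schur product theorem.\<close>

lemma positive_op_double_sum:
  fixes P :: "'b::chilbert \<Rightarrow> 'b" and A :: "'a::chilbert \<Rightarrow> 'a" and \<xi> :: "'i \<Rightarrow> 'b" and T :: "'i set"
  assumes sep: "separable (UNIV :: 'b set)" and P: "positive_op P"
    and A: "bop A" "\<And>x. norm (A x) \<le> K * norm x" and "0 \<le> K"
  defines "q \<eta> \<equiv> Re (\<Sum>i\<in>T. \<Sum>j\<in>T. cinner (\<eta> i) (\<eta> j) * cinner (\<xi> i) (P (\<xi> j)))"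
  shows "0 \<le> q \<eta>"
    and "cmod (\<Sum>i\<in>T. \<Sum>j\<in>T. cinner (\<eta> i) (A (\<eta>' j)) * cinner (\<xi> i) (P (\<xi> j))) \<le> K / 2 * (q \<eta> + q \<eta>')"
proof -
  obtain v where v: "\<And>x y. (\<lambda>m::nat. cinner x (v m) * cinner (v m) y) sums cinner x (P y)"
    using rank_one_decomposition[OF sep P] by blast
  \<comment> \<open>The contraction of \<Sum> \<eta> i \<otimes> \<xi> i with \<open>v m\<close> in
    the second factor.\<close>
  define z where "z \<eta> m = (\<Sum>i\<in>T. cscale (cinner (v m) (\<xi> i)) (\<eta> i))" for \<eta> :: "'i \<Rightarrow> 'a" and m
  have form: "(\<lambda>m. cinner (z \<eta> m) (B (z \<eta>' m))) sums
      (\<Sum>i\<in>T. \<Sum>j\<in>T. cinner (\<eta> i) (B (\<eta>' j)) * cinner (\<xi> i) (P (\<xi> j)))"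
    if B: "bop B" for B :: "'a \<Rightarrow> 'a" and \<eta> \<eta>'
  proof -
    have "cinner (z \<eta> m) (B (z \<eta>' m)) = (\<Sum>i\<in>T. \<Sum>j\<in>T. cinner (\<eta> i) (B (\<eta>' j)) *
        (cinner (\<xi> i) (v m) * cinner (v m) (\<xi> j)))" for m
    proof -
      have "cnj (cinner (v m) (\<xi> i)) = cinner (\<xi> i) (v m)" for i by (metis cinner_conj)
      thus ?thesis
        by (simp add: z_def bop_sum[OF B] bopD(2)[OF B] cinner_sum_left cinner_sum_right
            cinner_cscale_left cinner_cscale_right sum_distrib_left mult_ac) (rule sum.swap)
    qed
    thus ?thesis by (simp only:) (intro sums_sum sums_mult v)
  qed
  \<comment> \<open>The case B = id: the form without \<open>A\<close> is a sum of squared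
    norms.\<close>
  have q: "(\<lambda>m. (norm (z \<eta> m))\<^sup>2) sums q \<eta>" for \<eta>
    using sums_Re[OF form[OF bop_id, of \<eta> \<eta>]] by (simp add: q_def cinner_self)
  show "0 \<le> q \<eta>" by (rule sums_le[OF _ sums_zero q]) simp
  show "cmod (\<Sum>i\<in>T. \<Sum>j\<in>T. cinner (\<eta> i) (A (\<eta>' j)) * cinner (\<xi> i) (P (\<xi> j))) \<le> K / 2 * (q \<eta> + q \<eta>')"
  proof (rule norm_sums_le[OF form[OF A(1)] sums_mult[OF sums_add[OF q q]]])
    fix m
    have "cmod (cinner (z \<eta> m) (A (z \<eta>' m))) \<le> norm (z \<eta> m) * (K * norm (z \<eta>' m))"
      by (rule order_trans[OF cmod_cinner_le mult_left_mono[OF A(2) norm_ge_zero]])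
    also have "\<dots> \<le> K / 2 * ((norm (z \<eta> m))\<^sup>2 + (norm (z \<eta>' m))\<^sup>2)"
      using mult_left_mono[OF zero_le_power2[of "norm (z \<eta> m) - norm (z \<eta>' m)"] \<open>0 \<le> K\<close>]
      by (simp add: power2_diff field_simps)
    finally show "cmod (cinner (z \<eta> m) (A (z \<eta>' m))) \<le> K / 2 * ((norm (z \<eta> m))\<^sup>2 + (norm (z \<eta>' m))\<^sup>2)" .
  qed
qed

lemma norm_tensor_sum_sq:
  assumes "is_tensor t"
  shows "(norm (\<Sum>i\<in>T. t (\<eta> i) (\<xi> i)))\<^sup>2
    = Re (\<Sum>i\<in>T. \<Sum>j\<in>T. cinner (\<eta> i) (\<eta> j) * cinner (\<xi> i) (\<xi> j))"
proof -
  have "(norm (\<Sum>i\<in>T. t (\<eta> i) (\<xi> i)))\<^sup>2 = Re (cinner (\<Sum>i\<in>T. t (\<eta> i) (\<xi> i)) (\<Sum>i\<in>T. t (\<eta> i) (\<xi> i)))"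
    by (simp only: cinner_self Re_complex_of_real)
  also have "\<dots> = Re (\<Sum>j\<in>T. \<Sum>i\<in>T. cinner (\<eta> i) (\<eta> j) * cinner (\<xi> i) (\<xi> j))"
    by (simp only: cinner_sum_left cinner_sum_right tensor_simps(5)[OF assms])
  finally show ?thesis by (subst sum.swap)
qed

section \<open>Unitary representations and the scalar measures of a POM\<close>

lemma unitary_rep_simps:
  assumes "scurep G U"
  shows "bop (U g)" "cinner (U g x) (U g y) = cinner x y" "norm (U g x) = norm x" "U 0 x = x"
    "adj (U g) = U (- g)" "cinner x (U g y) = cinner (U (- g) x) y"
    "continuous_on UNIV (\<lambda>g. U g x)"
proof -
  show bU: "bop (U g)" and inn: "cinner (U g x) (U g y) = cinner x y" and U0: "U 0 x = x"
    and "continuous_on UNIV (\<lambda>g. U g x)" for g x y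
    using assms by (auto simp: scurep_def unitary_def)
  show "norm (U g x) = norm x" by (simp add: norm_cinner inn)
  show star: "cinner x (U g y) = cinner (U (- g) x) y" for g x y
  proof -
    have "U (g + - g) = U g \<circ> U (- g)" using assms unfolding scurep_def by blast
    hence "U g (U (- g) x) = x" using U0[of x] by (simp add: fun_eq_iff)
    thus ?thesis using inn[of g "U (- g) x" y] by simp
  qed
  show "adj (U g) = U (- g)"
    unfolding adj_def
  proof (rule the_equality)
    show "\<forall>x y. cinner x (U g y) = cinner (U (- g) x) y" by (simp add: star)
    show "B = U (- g)" if "\<forall>x y. cinner x (U g y) = cinner (B x) y" for B
      by (rule ext, rule cinner_ext_left) (metis that star)
  qed
qed

lemma gsets_simps:
  "sets (restrict_space borel (gcarrier G)) = gsets G" "space (restrict_space borel (gcarrier G)) = gcarrier G"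
  by (simp_all add: gsets_def space_restrict_space)

lemma gsets_iff: "X \<in> gsets G \<longleftrightarrow> X \<in> sets borel \<and> X \<subseteq> gcarrier G"
proof -
  have "gcarrier G \<in> sets borel" by (cases G) auto
  thus ?thesis unfolding gsets_def by (subst sets_restrict_space_iff) auto
qed

context
  fixes G :: grp and F :: "real set \<Rightarrow> 'b::chilbert \<Rightarrow> 'b"
  assumes pom: "pom G F"
begin

lemma pom_positive: "X \<in> gsets G \<Longrightarrow> positive_op (F X)"
  using pom by (simp add: pom_def)

lemma pom_carrier: "F (gcarrier G) = id"
  using pom by (simp add: pom_def)

lemma pom_sums: "range Xs \<subseteq> gsets G \<Longrightarrow> disjoint_family Xs \<Longrightarrow>
    (\<lambda>n. cinner x (F (Xs n) y)) sums cinner x (F (\<Union>n. Xs n) y)"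
  using pom by (simp add: pom_def)

text \<open>The constant family {} is disjoint, so countable additivity makes a series with constant
  terms converge.\<close>

lemma pom_empty: "F {} = (\<lambda>_. 0)"
proof
  fix y
  have "cinner x (F {} y) = 0" for x
  proof -
    have "(\<lambda>n::nat. cinner x (F {} y)) sums cinner x (F {} y)"
      using pom_sums[of "\<lambda>_. {}" x y] by (simp add: gsets_iff disjoint_family_on_def)
    hence "(\<lambda>n::nat. cinner x (F {} y)) \<longlonglongrightarrow> 0" by (intro summable_LIMSEQ_zero sums_summable)
    thus ?thesis by (simp add: LIMSEQ_const_iff)
  qed
  thus "F {} y = 0" by - (rule cinner_ext, simp)
qed

lemma sets_pom_measure [simp, measurable_cong]: "sets (pom_measure G F \<xi>) = gsets G"
proof -
  have "sigma_sets (gcarrier G) (gsets G) = gsets G"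
    using sets.sigma_sets_eq[of "restrict_space borel (gcarrier G)"] by (simp add: gsets_simps)
  thus ?thesis unfolding pom_measure_def by (subst sets_measure_of) (auto simp: gsets_iff)
qed

lemma space_pom_measure [simp]: "space (pom_measure G F \<xi>) = gcarrier G"
  unfolding pom_measure_def by (rule space_measure_of) (auto simp: gsets_iff)

lemma emeasure_pom_measure:
  assumes "X \<in> gsets G"
  shows "emeasure (pom_measure G F \<xi>) X = ennreal (Re (cinner \<xi> (F X \<xi>)))"
proof (rule emeasure_measure_of[OF pom_measure_def])
  have pos: "0 \<le> Re (cinner \<xi> (F X \<xi>))" if "X \<in> gsets G" for X
    using pom_positive[OF that] by (simp add: positive_op_def)
  show "positive (sets (pom_measure G F \<xi>)) (\<lambda>X. ennreal (Re (cinner \<xi> (F X \<xi>))))"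
    by (simp add: positive_def pom_empty)
  show "countably_additive (sets (pom_measure G F \<xi>)) (\<lambda>X. ennreal (Re (cinner \<xi> (F X \<xi>))))"
  proof (rule countably_additiveI)
    fix Xs :: "nat \<Rightarrow> real set"
    assume "range Xs \<subseteq> sets (pom_measure G F \<xi>)" "disjoint_family Xs"
    thus "(\<Sum>i. ennreal (Re (cinner \<xi> (F (Xs i) \<xi>)))) = ennreal (Re (cinner \<xi> (F (\<Union> (range Xs)) \<xi>)))"
      by (intro suminf_ennreal_eq sums_Re pom_sums) (auto intro: pos)
  qed
qed (use assms in \<open>auto simp: gsets_iff\<close>)

lemma finite_pom_measure: "finite_measure (pom_measure G F \<xi>)"
proof (rule finite_measureI)
  have "gcarrier G \<in> gsets G" by (cases G) (auto simp: gsets_iff)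
  thus "emeasure (pom_measure G F \<xi>) (space (pom_measure G F \<xi>)) \<noteq> \<infinity>"
    by (simp add: emeasure_pom_measure)
qed

lemma measure_pom_measure:
  assumes "X \<in> gsets G"
  shows "complex_of_real (measure (pom_measure G F \<xi>) X) = cinner \<xi> (F X \<xi>)"
proof -
  have "Im (cinner \<xi> (F X \<xi>)) = 0" "0 \<le> Re (cinner \<xi> (F X \<xi>))"
    using pom_positive[OF assms] by (auto simp: positive_op_def)
  thus ?thesis by (simp add: measure_def emeasure_pom_measure[OF assms] complex_eq_iff)
qed

lemma measure_pom_space: "measure (pom_measure G F \<xi>) (gcarrier G) = (norm \<xi>)\<^sup>2"
proof -
  have "gcarrier G \<in> gsets G" by (cases G) (auto simp: gsets_iff)
  from measure_pom_measure[OF this] show ?thesis by (simp add: pom_carrier cinner_self flip: of_real_power)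
qed

lemma borel_measurable_pom_measure:
  assumes "f \<in> borel_measurable borel"
  shows "f \<in> borel_measurable (pom_measure G F \<xi>)"
proof -
  have "f \<in> borel_measurable (pom_measure G F \<xi>) \<longleftrightarrow>
      f \<in> borel_measurable (restrict_space borel (gcarrier G))"
    by (rule arg_cong[where f = "\<lambda>S. f \<in> S"], rule measurable_cong_sets) (simp_all add: gsets_simps)
  thus ?thesis using measurable_restrict_space1[OF assms] by blast
qed

end

section \<open>Existence of the operator-valued integral\<close>

lemma continuous_on_conjugation_form:
  assumes U: "scurep G U" and A: "bop A"
  shows "continuous_on UNIV (\<lambda>g. cinner (U (- g) \<eta>) (A (U (- g) \<eta>')))"
proof -
  have "continuous_on UNIV (\<lambda>g. U (- g) x)" for x
    by (rule continuous_on_compose2[OF unitary_rep_simps(7)[OF U]]) (auto intro!: continuous_intros)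
  thus ?thesis
    by (intro continuous_intros bounded_linear.continuous_on[OF bop_bounded_linear[OF A]])
qed

lemma cmod_conjugation_form_le:
  assumes U: "scurep G U" and A: "\<And>x. norm (A x) \<le> K * norm x"
  shows "cmod (cinner (U (- g) \<eta>) (A (U (- g) \<eta>'))) \<le> K * norm \<eta> * norm \<eta>'"
  using order_trans[OF cmod_cinner_le mult_left_mono[OF A norm_ge_zero], of "U (- g) \<eta>" "U (- g) \<eta>'"]
  by (simp add: unitary_rep_simps(3)[OF U] mult_ac)

text \<open>\<open>int_decode\<close> enumerates the intervals of width 1/(n + 1) by natural
  numbers, the index type that countable additivity of a POM uses.\<close>

definition cell :: "grp \<Rightarrow> nat \<Rightarrow> nat \<Rightarrow> real set" where
  "cell G n m = {g \<in> gcarrier G. \<lfloor>g * real (Suc n)\<rfloor> = int_decode m}"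

text \<open>The left endpoint of the interval. For an empty cell it may lie outside the group's
  carrier; this is harmless because representations are indexed by all reals.\<close>

definition cell_point :: "nat \<Rightarrow> nat \<Rightarrow> real" where
  "cell_point n m = of_int (int_decode m) / real (Suc n)"

lemma cell_gsets: "cell G n m \<in> gsets G"
proof -
  have "gcarrier G \<in> sets borel" by (cases G) auto
  moreover have "{g :: real. \<lfloor>g * real (Suc n)\<rfloor> = int_decode m} \<in> sets borel"
  proof -
    have "{g :: real. \<lfloor>g * real (Suc n)\<rfloor> = int_decode m}
        = {of_int (int_decode m) / real (Suc n)..<(of_int (int_decode m) + 1) / real (Suc n)}"
      by (auto simp: floor_eq_iff field_simps)
    thus ?thesis by simp
  qed
  moreover have "cell G n m = gcarrier G \<inter> {g. \<lfloor>g * real (Suc n)\<rfloor> = int_decode m}"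
    by (auto simp: cell_def)
  ultimately show ?thesis by (auto simp: gsets_iff)
qed

lemma disjoint_cell: "disjoint_family (cell G n)"
proof -
  have "m = m'" if "int_decode m = int_decode m'" for m m'
    using that by (metis int_decode_inverse)
  thus ?thesis by (auto simp: disjoint_family_on_def cell_def)
qed

lemma UN_cell: "(\<Union>m. cell G n m) = gcarrier G"
proof -
  have "g \<in> cell G n (int_encode \<lfloor>g * real (Suc n)\<rfloor>)" if "g \<in> gcarrier G" for g
    using that by (simp add: cell_def)
  thus ?thesis by (fastforce simp: cell_def)
qed

lemma int_encode_le: "int_encode i \<le> 2 * nat \<bar>i\<bar> + 1"
  by (auto simp: int_encode_def sum_encode_def)

text \<open>The index of the cell containing \<open>g\<close> grows linearly in n, the truncation
  quadratically.\<close>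

lemma cell_index_eventually_less:
  "\<forall>\<^sub>F n in sequentially. int_encode \<lfloor>g * real (Suc n)\<rfloor> < (Suc n)\<^sup>2"
proof -
  have "int_encode \<lfloor>g * real (Suc n)\<rfloor> < (Suc n)\<^sup>2" if n: "real n \<ge> 2 * \<bar>g\<bar> + 3" for n
  proof -
    define N where "N = real (Suc n)"
    have N: "N \<ge> 2 * \<bar>g\<bar> + 4" using n by (simp add: N_def)
    have a: "\<bar>g * N\<bar> = \<bar>g\<bar> * N" by (simp add: abs_mult N_def)
    have "real (int_encode \<lfloor>g * N\<rfloor>) \<le> 2 * real (nat \<bar>\<lfloor>g * N\<rfloor>\<bar>) + 1"
      using int_encode_le[of "\<lfloor>g * N\<rfloor>"] by linarith
    also have "real (nat \<bar>\<lfloor>g * N\<rfloor>\<bar>) \<le> \<bar>g\<bar> * N + 1" unfolding a[symmetric] by linarith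
    also have "2 * (\<bar>g\<bar> * N + 1) + 1 < (2 * \<bar>g\<bar> + 4) * N"
      using N by (simp add: algebra_simps)
    also have "\<dots> \<le> N * N" using N by (intro mult_right_mono) (auto simp: N_def)
    also have "N * N = real ((Suc n)\<^sup>2)" by (simp only: N_def of_nat_mult power2_eq_square)
    finally show ?thesis by (simp only: N_def of_nat_less_iff)
  qed
  moreover have "\<forall>\<^sub>F n in sequentially. real n \<ge> 2 * \<bar>g\<bar> + 3"
    using filterlim_real_sequentially by (simp add: filterlim_at_top)
  ultimately show ?thesis by (auto elim: eventually_mono)
qed

text \<open>Riemann sums over the cells; the index is truncated at \<open>(Suc n)\<^sup>2\<close>, so the sums stay finite
  while the cells they use still exhaust the group.\<close>

lemma riemann_sums_tendsto:
  fixes f :: "real \<Rightarrow> complex"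
  assumes pom: "pom G F" and cont: "continuous_on UNIV f" and bd: "\<And>g. cmod (f g) \<le> K"
  shows "(\<lambda>n. \<Sum>m<(Suc n)\<^sup>2. f (cell_point n m) * cinner \<xi> (F (cell G n m) \<xi>))
    \<longlonglongrightarrow> integral\<^sup>L (pom_measure G F \<xi>) f"
proof -
  interpret finite_measure "pom_measure G F \<xi>" by (rule finite_pom_measure[OF pom])
  let ?M = "pom_measure G F \<xi>"
  define s where "s n g = (\<Sum>m<(Suc n)\<^sup>2. indicator (cell G n m) g *\<^sub>R f (cell_point n m))" for n g
  have cell_M: "cell G n m \<in> sets ?M" for n m by (simp add: sets_pom_measure[OF pom] cell_gsets)
  have int: "integral\<^sup>L ?M (s n) = (\<Sum>m<(Suc n)\<^sup>2. f (cell_point n m) * cinner \<xi> (F (cell G n m) \<xi>))" for n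
  proof -
    have "integral\<^sup>L ?M (s n) = (\<Sum>m<(Suc n)\<^sup>2. \<integral>g. indicator (cell G n m) g *\<^sub>R f (cell_point n m) \<partial>?M)"
      unfolding s_def by (intro Bochner_Integration.integral_sum integrable_scaleR_left integrable_real_indicator cell_M)
        (simp add: emeasure_eq_measure)
    also have "\<dots> = (\<Sum>m<(Suc n)\<^sup>2. measure ?M (cell G n m) *\<^sub>R f (cell_point n m))"
      using cell_M by (intro sum.cong refl) (simp add: emeasure_eq_measure)
    finally show ?thesis
      by (simp add: scaleR_conv_of_real measure_pom_measure[OF pom cell_gsets] mult.commute)
  qed
  \<comment> \<open>At most one cell contains \<open>g\<close>, so the step function takes the value
    of \<open>f\<close> at a left endpoint, or 0 when that cell lies beyond the truncation.\<close>
  have s: "s n g = (if int_encode \<lfloor>g * real (Suc n)\<rfloor> < (Suc n)\<^sup>2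
      then f (of_int \<lfloor>g * real (Suc n)\<rfloor> / real (Suc n)) else 0)" if g: "g \<in> gcarrier G" for n g
  proof -
    let ?m = "int_encode \<lfloor>g * real (Suc n)\<rfloor>"
    have "g \<in> cell G n m \<longleftrightarrow> m = ?m" for m
      using g by (auto simp: cell_def)
    hence "s n g = (\<Sum>m<(Suc n)\<^sup>2. if m = ?m then f (cell_point n m) else 0)"
      unfolding s_def by (intro sum.cong refl) (simp add: indicator_def)
    thus ?thesis by (simp add: cell_point_def)
  qed
  have K0: "0 \<le> K" using bd[of 0] norm_ge_zero by (rule order_trans[rotated])
  have "(\<lambda>n. integral\<^sup>L ?M (s n)) \<longlonglongrightarrow> integral\<^sup>L ?M f"
  proof (rule integral_dominated_convergence[where w = "\<lambda>_. K"])
    show "f \<in> borel_measurable ?M"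
      by (intro borel_measurable_pom_measure[OF pom] borel_measurable_continuous_onI cont)
    show "s n \<in> borel_measurable ?M" for n
      unfolding s_def using cell_M
      by (intro borel_measurable_sum borel_measurable_scaleR borel_measurable_indicator) auto
    show "integrable ?M (\<lambda>_. K)" by simp
    show "AE g in ?M. cmod (s n g) \<le> K" for n
      by (rule AE_I2) (use bd K0 in \<open>simp add: s space_pom_measure[OF pom]\<close>)
    show "AE g in ?M. (\<lambda>n. s n g) \<longlonglongrightarrow> f g"
    proof (rule AE_I2)
      fix g assume "g \<in> space ?M"
      hence g: "g \<in> gcarrier G" by (simp add: space_pom_measure[OF pom])
      have "(\<lambda>n. of_int \<lfloor>g * real (Suc n)\<rfloor> / real (Suc n)) \<longlonglongrightarrow> g"
      proof (rule tendsto_sandwich)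
        show "\<forall>\<^sub>F n in sequentially. g - inverse (real (Suc n)) \<le> of_int \<lfloor>g * real (Suc n)\<rfloor> / real (Suc n)"
        proof (intro always_eventually allI)
          fix n
          have "g - inverse (real (Suc n)) = (g * real (Suc n) - 1) / real (Suc n)"
            by (simp add: field_simps)
          also have "\<dots> \<le> of_int \<lfloor>g * real (Suc n)\<rfloor> / real (Suc n)"
            by (intro divide_right_mono) linarith+
          finally show "g - inverse (real (Suc n)) \<le> of_int \<lfloor>g * real (Suc n)\<rfloor> / real (Suc n)" .
        qed
        show "\<forall>\<^sub>F n in sequentially. of_int \<lfloor>g * real (Suc n)\<rfloor> / real (Suc n) \<le> g"
          by (intro always_eventually allI) (simp add: field_simps)
        show "(\<lambda>n. g - inverse (real (Suc n))) \<longlonglongrightarrow> g"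
          using tendsto_diff[OF tendsto_const LIMSEQ_inverse_real_of_nat, of g] by simp
      qed simp
      hence "(\<lambda>n. f (of_int \<lfloor>g * real (Suc n)\<rfloor> / real (Suc n))) \<longlonglongrightarrow> f g"
        by (rule continuous_on_tendsto_compose[OF cont]) auto
      thus "(\<lambda>n. s n g) \<longlonglongrightarrow> f g"
        by (rule Lim_transform_eventually)
          (use cell_index_eventually_less[of g] in eventually_elim, simp add: s[OF g])
    qed
  qed
  thus ?thesis unfolding int .
qed

section \<open>Riemann sums of the operator-valued integral\<close>

context
  fixes G :: grp
    and U :: "real \<Rightarrow> 'a::chilbert \<Rightarrow> 'a"
    and F :: "real set \<Rightarrow> 'b::chilbert \<Rightarrow> 'b"
    and t :: "'a \<Rightarrow> 'b \<Rightarrow> 'c::chilbert"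
    and A :: "'a \<Rightarrow> 'a"
  assumes sep: "separable (UNIV :: 'b set)" and t: "is_tensor t"
    and U: "scurep G U" and pom: "pom G F" and A: "bop A"
begin

text \<open>The matrix element between product vectors of a truncated Riemann sum of \<integral>
  U(g) A U(g)* \<otimes> F(dg). Pairs serve as indices so that \<open>bop_from_kernel\<close>
  applies to its limit.\<close>

definition riemann_form :: "nat \<Rightarrow> 'a \<times> 'b \<Rightarrow> 'a \<times> 'b \<Rightarrow> complex" where
  "riemann_form n p p' = (\<Sum>m<(Suc n)\<^sup>2.
     cinner (U (- cell_point n m) (fst p)) (A (U (- cell_point n m) (fst p'))) *
     cinner (snd p) (F (cell G n m) (snd p')))"

lemma riemann_form_diagonal:
  "(\<lambda>n. riemann_form n (\<eta>, \<xi>) (\<eta>', \<xi>)) \<longlonglongrightarrow>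
    (\<integral>g. cinner (U (- g) \<eta>) (A (U (- g) \<eta>')) \<partial>pom_measure G F \<xi>)"
proof -
  obtain K where K: "K > 0" "\<And>x. norm (A x) \<le> K * norm x" using bop_bound[OF A] by metis
  show ?thesis
    unfolding riemann_form_def fst_conv snd_conv
    by (rule riemann_sums_tendsto[OF pom continuous_on_conjugation_form[OF U A]
          cmod_conjugation_form_le[OF U K(2)]])
qed

text \<open>Only the second factor is polarised: \<open>pom_measure\<close> exists just for equal
  vectors there, while the diagonal limit already allows different \<eta> and \<eta>'.\<close>

lemma riemann_form_polarization:
  "4 * riemann_form n (\<eta>, \<xi>) (\<eta>', \<xi>') =
     riemann_form n (\<eta>, \<xi> + \<xi>') (\<eta>', \<xi> + \<xi>') - riemann_form n (\<eta>, \<xi> - \<xi>') (\<eta>', \<xi> - \<xi>')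
     - \<i> * riemann_form n (\<eta>, \<xi> + cscale \<i> \<xi>') (\<eta>', \<xi> + cscale \<i> \<xi>')
     + \<i> * riemann_form n (\<eta>, \<xi> - cscale \<i> \<xi>') (\<eta>', \<xi> - cscale \<i> \<xi>')"
proof -
  have "4 * (a * cinner \<xi> (F (cell G n m) \<xi>')) =
      a * cinner (\<xi> + \<xi>') (F (cell G n m) (\<xi> + \<xi>'))
      - a * cinner (\<xi> - \<xi>') (F (cell G n m) (\<xi> - \<xi>'))
      - \<i> * (a * cinner (\<xi> + cscale \<i> \<xi>') (F (cell G n m) (\<xi> + cscale \<i> \<xi>')))
      + \<i> * (a * cinner (\<xi> - cscale \<i> \<xi>') (F (cell G n m) (\<xi> - cscale \<i> \<xi>')))" for a m
    using arg_cong[OF polarization[OF positive_op_bop[OF pom_positive[OF pom cell_gsets[of G n m]]], of \<xi> \<xi>'],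
        of "\<lambda>z. a * z"]
    by (simp add: algebra_simps)
  thus ?thesis
    by (simp add: riemann_form_def sum_distrib_left sum.distrib sum_subtractf)
qed

lemma riemann_form_convergent: "convergent (\<lambda>n. riemann_form n p p')"
proof -
  obtain \<eta> \<xi> \<eta>' \<xi>' where p: "p = (\<eta>, \<xi>)" "p' = (\<eta>', \<xi>')" by (metis surj_pair)
  have "convergent (\<lambda>n. 4 * riemann_form n p p')"
    unfolding p riemann_form_polarization
    by (intro convergent_add convergent_diff convergent_mult convergent_const)
      (rule convergentI, rule riemann_form_diagonal)+
  from convergent_mult[OF convergent_const[of "1/4"] this] show ?thesis by simp
qed

text \<open>On each cell \<open>positive_op_double_sum\<close> bounds the form by quantities from
  which the unitaries drop out. Those quantities add up over all cells to squared tensor norms,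
  which makes the bound independent of n.\<close>

lemma riemann_form_bound:
  fixes T :: "('a \<times> 'b) set"
  assumes K: "\<And>x. norm (A x) \<le> K * norm x" "0 \<le> K"
  shows "cmod (\<Sum>p\<in>T. \<Sum>p'\<in>T. cnj (c p) * d p' * riemann_form n p p')
    \<le> K / 2 * ((norm (\<Sum>p\<in>T. cscale (c p) (case_prod t p)))\<^sup>2
      + (norm (\<Sum>p\<in>T. cscale (d p) (case_prod t p)))\<^sup>2)"
proof -
  define V where "V m = U (- cell_point n m)" for m
  define q where "q m e = Re (\<Sum>p\<in>T. \<Sum>p'\<in>T. cinner (cscale (e p) (fst p)) (cscale (e p') (fst p')) *
      cinner (snd p) (F (cell G n m) (snd p')))" for m e
  define Q where "Q m = (\<Sum>p\<in>T. \<Sum>p'\<in>T. cinner (V m (cscale (c p) (fst p))) (A (V m (cscale (d p') (fst p')))) *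
      cinner (snd p) (F (cell G n m) (snd p')))" for m
  have V: "cinner (V m x) (V m y) = cinner x y" for m x y
    by (simp add: V_def unitary_rep_simps(2)[OF U])
  have pos: "positive_op (F (cell G n m))" for m by (rule pom_positive[OF pom cell_gsets])
  have q0: "0 \<le> q m e" for m e
    unfolding q_def by (rule positive_op_double_sum(1)[OF sep pos A K])
  have Qm: "cmod (Q m) \<le> K / 2 * (q m c + q m d)" for m
    using positive_op_double_sum(2)[OF sep pos A K, where \<eta> = "\<lambda>p. V m (cscale (c p) (fst p))"
        and \<eta>' = "\<lambda>p. V m (cscale (d p) (fst p))" and \<xi> = snd and T = T]
    unfolding Q_def q_def V .
  \<comment> \<open>The cells partition the group and F(G) is the identity, so the full series is
    exact; the truncated sum below only drops nonnegative terms.\<close>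
  have qs: "(\<lambda>m. q m e) sums (norm (\<Sum>p\<in>T. cscale (e p) (case_prod t p)))\<^sup>2" for e
  proof -
    have "(\<lambda>m. cinner x (F (cell G n m) y)) sums cinner x y" for x y
      using pom_sums[OF pom, of "cell G n" x y]
      by (simp add: UN_cell pom_carrier[OF pom] disjoint_cell cell_gsets image_subset_iff)
    hence "(\<lambda>m. q m e) sums Re (\<Sum>p\<in>T. \<Sum>p'\<in>T. cinner (cscale (e p) (fst p)) (cscale (e p') (fst p')) *
        cinner (snd p) (snd p'))"
      unfolding q_def by (intro sums_Re sums_sum sums_mult)
    thus ?thesis
      unfolding norm_tensor_sum_sq[OF t, symmetric]
      by (simp add: tensor_simps(3)[OF t] case_prod_unfold)
  qed
  have qle: "(\<Sum>m<(Suc n)\<^sup>2. q m e) \<le> (norm (\<Sum>p\<in>T. cscale (e p) (case_prod t p)))\<^sup>2" for e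
    using sum_le_suminf[OF sums_summable[OF qs[of e]], of "{..<(Suc n)\<^sup>2}"] q0 sums_unique[OF qs[of e]]
    by simp
  have "(\<Sum>p\<in>T. \<Sum>p'\<in>T. cnj (c p) * d p' * riemann_form n p p')
      = (\<Sum>p\<in>T. \<Sum>p'\<in>T. \<Sum>m<(Suc n)\<^sup>2. cinner (V m (cscale (c p) (fst p))) (A (V m (cscale (d p') (fst p')))) *
      cinner (snd p) (F (cell G n m) (snd p')))"
    by (simp add: riemann_form_def V_def sum_distrib_left bopD(2)[OF A] bopD(2)[OF unitary_rep_simps(1)[OF U]]
        cinner_cscale_left cinner_cscale_right mult_ac)
  also have "\<dots> = (\<Sum>p\<in>T. \<Sum>m<(Suc n)\<^sup>2. \<Sum>p'\<in>T. cinner (V m (cscale (c p) (fst p))) (A (V m (cscale (d p') (fst p')))) *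
      cinner (snd p) (F (cell G n m) (snd p')))"
    by (intro sum.cong refl sum.swap)
  also have "\<dots> = (\<Sum>m<(Suc n)\<^sup>2. Q m)" unfolding Q_def by (rule sum.swap)
  finally have "cmod (\<Sum>p\<in>T. \<Sum>p'\<in>T. cnj (c p) * d p' * riemann_form n p p') \<le> (\<Sum>m<(Suc n)\<^sup>2. cmod (Q m))"
    by (simp only: norm_sum)
  also have "\<dots> \<le> (\<Sum>m<(Suc n)\<^sup>2. K / 2 * (q m c + q m d))" by (intro sum_mono Qm)
  also have "\<dots> = K / 2 * ((\<Sum>m<(Suc n)\<^sup>2. q m c) + (\<Sum>m<(Suc n)\<^sup>2. q m d))"
    by (simp only: sum.distrib flip: sum_distrib_left)
  also have "\<dots> \<le> K / 2 * ((norm (\<Sum>p\<in>T. cscale (c p) (case_prod t p)))\<^sup>2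
      + (norm (\<Sum>p\<in>T. cscale (d p) (case_prod t p)))\<^sup>2)"
    using K(2) by (intro mult_left_mono add_mono qle) auto
  finally show ?thesis .
qed

text \<open>The limit kernel inherits the uniform bound and so comes from a bounded operator. With
  uniqueness from \<open>tensor_quadratic_eqI\<close>, the description in \<open>yen\<close> is
  resolved.\<close>

lemma yen_characterization:
  shows "bop (yen G U F t A)"
    and "cinner (t \<eta> \<xi>) (yen G U F t A (t \<eta> \<xi>)) =
      (\<integral>g. cinner (U (- g) \<eta>) (A (U (- g) \<eta>)) \<partial>pom_measure G F \<xi>)"
proof -
  obtain K where K: "K > 0" "\<And>x. norm (A x) \<le> K * norm x" using bop_bound[OF A] by metis
  have lim: "(\<lambda>n. riemann_form n p p') \<longlonglongrightarrow> lim (\<lambda>n. riemann_form n p p')" for p p'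
    using riemann_form_convergent by (simp add: convergent_LIMSEQ_iff)
  have "\<exists>Y. bop Y \<and> (\<forall>p p'. cinner (case_prod t p) (Y (case_prod t p')) = lim (\<lambda>n. riemann_form n p p'))"
  proof (rule bop_from_kernel[OF tensor_dense[OF t], where K = "K / 2"])
    fix T and c d :: "'a \<times> 'b \<Rightarrow> complex"
    show "cmod (\<Sum>p\<in>T. \<Sum>p'\<in>T. cnj (c p) * d p' * lim (\<lambda>n. riemann_form n p p'))
      \<le> K / 2 * ((norm (\<Sum>p\<in>T. cscale (c p) (case_prod t p)))\<^sup>2
        + (norm (\<Sum>p\<in>T. cscale (d p) (case_prod t p)))\<^sup>2)"
    proof (rule LIMSEQ_le_const2)
      show "(\<lambda>n. cmod (\<Sum>p\<in>T. \<Sum>p'\<in>T. cnj (c p) * d p' * riemann_form n p p'))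
        \<longlonglongrightarrow> cmod (\<Sum>p\<in>T. \<Sum>p'\<in>T. cnj (c p) * d p' * lim (\<lambda>n. riemann_form n p p'))"
        by (intro tendsto_norm tendsto_sum tendsto_mult tendsto_const lim)
    qed (use riemann_form_bound[OF K(2)] K(1) in auto)
  qed (use K in simp)
  then obtain Y where Y: "bop Y"
    "\<And>p p'. cinner (case_prod t p) (Y (case_prod t p')) = lim (\<lambda>n. riemann_form n p p')" by blast
  have quad: "cinner (t \<eta> \<xi>) (Y (t \<eta> \<xi>)) =
      (\<integral>g. cinner (U (- g) \<eta>) (A (U (- g) \<eta>)) \<partial>pom_measure G F \<xi>)" for \<eta> \<xi>
    using Y(2)[of "(\<eta>, \<xi>)" "(\<eta>, \<xi>)"] limI[OF riemann_form_diagonal] by simp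
  have integrand: "cinner \<eta> (U g (A (adj (U g) \<eta>))) = cinner (U (- g) \<eta>) (A (U (- g) \<eta>))" for \<eta> g
    by (simp only: unitary_rep_simps(5)[OF U]) (rule unitary_rep_simps(6)[OF U])
  have "yen G U F t A = Y"
    unfolding yen_def integrand
  proof (rule the_equality)
    show "Z = Y" if "bop Z \<and> (\<forall>\<eta> \<xi>. cinner (t \<eta> \<xi>) (Z (t \<eta> \<xi>)) =
        (\<integral>g. cinner (U (- g) \<eta>) (A (U (- g) \<eta>)) \<partial>pom_measure G F \<xi>))" for Z
      using that Y(1) by (intro tensor_quadratic_eqI[OF t]) (auto simp: quad)
  qed (use Y(1) quad in auto)
  thus "bop (yen G U F t A)" "cinner (t \<eta> \<xi>) (yen G U F t A (t \<eta> \<xi>)) =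
      (\<integral>g. cinner (U (- g) \<eta>) (A (U (- g) \<eta>)) \<partial>pom_measure G F \<xi>)"
    using Y(1) quad by auto
qed

end

section \<open>Localized reference states\<close>

text \<open>Splitting at \<open>X n\<close>: on it \<open>f\<close> is close to f(0) by continuity,
  off it the error is at most 2C on a set whose mass tends to 0.\<close>

lemma integral_concentrating_tendsto:
  fixes f :: "real \<Rightarrow> complex" and M :: "nat \<Rightarrow> real measure"
  assumes fin: "\<And>n. finite_measure (M n)" and tot: "\<And>n. measure (M n) (space (M n)) = 1"
    and meas: "\<And>n. f \<in> borel_measurable (M n)" and bd: "\<And>g. cmod (f g) \<le> C"
    and cont: "continuous_on UNIV f"
    and X: "\<And>n. X n \<in> sets (M n)" "(\<lambda>n. measure (M n) (X n)) \<longlonglongrightarrow> 1"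
    and shrink: "\<And>d. d > 0 \<Longrightarrow> \<forall>\<^sub>F n in sequentially. \<forall>g\<in>X n. \<bar>g\<bar> < d"
  shows "(\<lambda>n. integral\<^sup>L (M n) f) \<longlonglongrightarrow> f 0"
proof (rule tendstoI)
  fix e :: real assume e: "0 < e"
  have C0: "0 \<le> C" using bd[of 0] norm_ge_zero by (rule order_trans[rotated])
  obtain d where "d > 0" "\<forall>g. dist g 0 < d \<longrightarrow> dist (f g) (f 0) < e / 2"
    using cont half_gt_zero[OF e] unfolding continuous_on_iff by (metis UNIV_I)
  hence d: "d > 0" "\<And>g. \<bar>g\<bar> < d \<Longrightarrow> cmod (f g - f 0) < e / 2"
    by (simp_all add: dist_norm)
  have "(\<lambda>n. e / 2 + 2 * C * (1 - measure (M n) (X n))) \<longlonglongrightarrow> e / 2 + 2 * C * (1 - 1)"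
    by (intro tendsto_add tendsto_mult tendsto_diff tendsto_const X(2))
  hence "\<forall>\<^sub>F n in sequentially. e / 2 + 2 * C * (1 - measure (M n) (X n)) < e"
    by (rule order_tendstoD) (use e in simp)
  with shrink[OF d(1)] show "\<forall>\<^sub>F n in sequentially. dist (integral\<^sup>L (M n) f) (f 0) < e"
  proof eventually_elim
    case (elim n)
    interpret finite_measure "M n" by (rule fin)
    have int_f: "integrable (M n) f"
      by (rule integrable_const_bound[of _ C]) (auto simp: bd meas)
    have i: "integrable (M n) (indicator (X n) :: real \<Rightarrow> real)"
      using X(1) by (intro integrable_real_indicator) (simp_all add: emeasure_eq_measure)
    have "integral\<^sup>L (M n) f - f 0 = (\<integral>g. f g - f 0 \<partial>M n)"
      using int_f by (simp add: tot)
    also have "cmod \<dots> \<le> (\<integral>g. cmod (f g - f 0) \<partial>M n)" by (rule integral_norm_bound)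
    also have "\<dots> \<le> (\<integral>g. e / 2 + 2 * C * (1 - indicator (X n) g) \<partial>M n)"
    proof (rule integral_mono)
      show "integrable (M n) (\<lambda>g. cmod (f g - f 0))"
        by (intro integrable_norm Bochner_Integration.integrable_diff int_f integrable_const)
      show "integrable (M n) (\<lambda>g. e / 2 + 2 * C * (1 - indicator (X n) g :: real))"
        by (intro Bochner_Integration.integrable_add integrable_mult_right
            Bochner_Integration.integrable_diff integrable_const i)
      show "cmod (f g - f 0) \<le> e / 2 + 2 * C * (1 - indicator (X n) g)" for g
      proof (cases "g \<in> X n")
        case True
        thus ?thesis using d(2)[of g] elim(1) by (simp add: less_imp_le)
      next
        case False
        have "cmod (f g - f 0) \<le> C + C" by (rule order_trans[OF norm_triangle_ineq4 add_mono[OF bd bd]])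
        thus ?thesis using False e by simp
      qed
    qed
    also have "\<dots> = e / 2 + 2 * C * (1 - measure (M n) (X n))"
    proof -
      have "(\<integral>g. indicator (X n) g \<partial>M n) = measure (M n) (X n)" using X(1) by simp
      thus ?thesis using i by (simp add: tot)
    qed
    finally show ?case using elim(2) by (simp add: dist_norm)
  qed
qed

text \<open>One-sided because 0 is the left end of the interval representing the circle. Its points
  are close to 0 as real numbers, so continuity on the real line suffices for both groups.\<close>

definition half_open_neighbourhood :: "nat \<Rightarrow> real set" where
  "half_open_neighbourhood n = {0..<2 * pi / real (Suc n)}"

lemma half_open_neighbourhood_gsets: "half_open_neighbourhood n \<in> gsets G"
proof -
  have "2 * pi / real (Suc n) \<le> 2 * pi" by (simp add: field_simps)
  thus ?thesis by (cases G) (auto simp: gsets_iff half_open_neighbourhood_def)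
qed

text \<open>A tile that starts before 2\<pi> also ends by 2\<pi>: the integer k is below n + 1,
  hence k + 1 is at most n + 1.\<close>

lemma tile_end_le:
  fixes k :: int
  assumes "of_int k * (2 * pi / real (Suc n)) < 2 * pi"
  shows "of_int (k + 1) * (2 * pi / real (Suc n)) \<le> 2 * pi"
proof -
  have "of_int k < real (Suc n)" using assms by (simp add: field_simps del: of_nat_Suc)
  hence "k < int (Suc n)" by (metis of_int_less_iff of_int_of_nat_eq)
  hence "k + 1 \<le> int (Suc n)" by linarith
  hence "of_int (k + 1) \<le> real_of_int (int (Suc n))" by (simp only: of_int_le_iff)
  hence "of_int (k + 1) \<le> real (Suc n)" by (simp only: of_int_of_nat_eq)
  thus ?thesis by (simp add: field_simps del: of_nat_Suc of_int_add)
qed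

text \<open>The width divides \<open>2 * pi\<close>, so on the circle the translates by multiples of the width
  tile the group without wrapping around.\<close>

lemma gshift_half_open_neighbourhood:
  fixes k :: int and n :: nat
  defines "\<delta> \<equiv> 2 * pi / real (Suc n)"
  assumes "of_int k * \<delta> \<in> gcarrier G"
  shows "gshift G (half_open_neighbourhood n) (of_int k * \<delta>) = {of_int k * \<delta>..<of_int (k + 1) * \<delta>}"
proof -
  have d: "\<delta> > 0" by (simp add: \<delta>_def)
  have "gadd G x (of_int k * \<delta>) = x + of_int k * \<delta>" if x: "0 \<le> x" "x < \<delta>" for x
  proof (cases G)
    case Circle
    have "of_int k * \<delta> < 2 * pi" "0 \<le> of_int k * \<delta>" using assms Circle by auto
    moreover have "of_int (k + 1) * \<delta> \<le> 2 * pi"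
      using tile_end_le[of k n] \<open>of_int k * \<delta> < 2 * pi\<close> by (simp only: \<delta>_def)
    ultimately have "x + of_int k * \<delta> < 2 * pi" "0 \<le> x + of_int k * \<delta>"
      using x by (simp_all add: algebra_simps)
    hence "\<lfloor>(x + of_int k * \<delta>) / (2 * pi)\<rfloor> = 0" by (simp add: floor_eq_iff field_simps)
    thus ?thesis by (simp add: Circle)
  qed simp
  hence "gshift G (half_open_neighbourhood n) (of_int k * \<delta>) = (\<lambda>x. x + of_int k * \<delta>) ` {0..<\<delta>}"
    unfolding gshift_def half_open_neighbourhood_def \<delta>_def[symmetric] by (intro image_cong) auto
  also have "\<dots> = {of_int k * \<delta>..<of_int (k + 1) * \<delta>}" by (simp add: algebra_simps)
  finally show ?thesis .
qed

lemma covariant_pom_neighbourhood_nonzero: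
  fixes F :: "real set \<Rightarrow> 'b::chilbert \<Rightarrow> 'b"
  assumes pom: "pom G F" and U: "scurep G U" and cov: "covariant G U F" and "\<xi> \<noteq> (0::'b)"
  shows "F (half_open_neighbourhood n) \<noteq> (\<lambda>_. 0)"
proof
  assume zero: "F (half_open_neighbourhood n) = (\<lambda>_. 0)"
  define \<delta> where "\<delta> = 2 * pi / real (Suc n)"
  have d: "\<delta> > 0" by (simp add: \<delta>_def)
  define Y where "Y k = {of_int k * \<delta>..<of_int (k + 1) * \<delta>} \<inter> gcarrier G" for k :: int
  have Y: "Y k \<in> gsets G \<and> F (Y k) = (\<lambda>_. 0)" for k
  \<comment> \<open>A tile starting inside the group is a translate, hence null by covariance. One
    starting outside, possible only on the circle, ends by 0 or starts at or after 2\<pi> and misses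
    the group.\<close>
  proof (cases "of_int k * \<delta> \<in> gcarrier G")
    case True
    have sub: "{of_int k * \<delta>..<of_int (k + 1) * \<delta>} \<subseteq> gcarrier G"
    proof (cases G)
      case Circle
      have k: "of_int k * \<delta> < 2 * pi" "0 \<le> of_int k * \<delta>" using True Circle by auto
      hence "of_int (k + 1) * \<delta> \<le> 2 * pi" using tile_end_le[of k n] by (simp only: \<delta>_def)
      thus ?thesis using k Circle by auto
    qed simp
    hence "Y k = gshift G (half_open_neighbourhood n) (of_int k * \<delta>)"
      using gshift_half_open_neighbourhood[of k n G] True by (auto simp: Y_def \<delta>_def)
    moreover have "F (gshift G (half_open_neighbourhood n) (of_int k * \<delta>)) = (\<lambda>_. 0)"
      using cov True half_open_neighbourhood_gsets[of n G] bopD(3)[OF unitary_rep_simps(1)[OF U]]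
      by (auto simp: covariant_def zero fun_eq_iff dest!: bspec)
    moreover have "Y k \<in> gsets G" using sub by (auto simp: Y_def gsets_iff Int_absorb2)
    ultimately show ?thesis by simp
  next
    case False
    hence "Y k = {}"
    proof (cases G)
      case Circle
      show ?thesis
      proof (cases "0 \<le> of_int k * \<delta>")
        case True
        thus ?thesis using False Circle by (auto simp: Y_def)
      next
        case neg: False
        hence "k + 1 \<le> 0" using d by (auto simp: zero_le_mult_iff)
        hence "of_int (k + 1) * \<delta> \<le> 0" using d by (intro mult_nonpos_nonneg) auto
        thus ?thesis using Circle by (auto simp: Y_def)
      qed
    qed simp
    thus ?thesis by (simp add: gsets_iff pom_empty[OF pom])
  qed
  let ?M = "pom_measure G F \<xi>"
  \<comment> \<open>Countably many null tiles cover a group whose mass is the squared norm of \<xi>,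
    a contradiction.\<close>
  have "(\<Union>k\<in>UNIV. Y k) \<in> null_sets ?M"
  proof (rule null_sets_UN')
    show "Y k \<in> null_sets ?M" for k
      using Y[of k] by (auto simp: null_sets_def sets_pom_measure[OF pom] emeasure_pom_measure[OF pom])
  qed simp
  moreover have "(\<Union>k\<in>UNIV. Y k) = gcarrier G"
  proof -
    have "g \<in> {of_int \<lfloor>g / \<delta>\<rfloor> * \<delta>..<of_int (\<lfloor>g / \<delta>\<rfloor> + 1) * \<delta>}" for g
    proof -
      have "of_int \<lfloor>g / \<delta>\<rfloor> \<le> g / \<delta>" "g / \<delta> < of_int (\<lfloor>g / \<delta>\<rfloor> + 1)" by linarith+
      thus ?thesis using d by (simp only: pos_le_divide_eq pos_divide_less_eq atLeastLessThan_iff)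
    qed
    thus ?thesis unfolding Y_def by blast
  qed
  ultimately have "measure ?M (gcarrier G) = 0" by (simp add: measure_eq_0_null_sets)
  thus False using \<open>\<xi> \<noteq> 0\<close> by (simp add: measure_pom_space[OF pom])
qed

text \<open>For each set the norm-1 property gives a whole sequence of unit vectors; one member with
  mass within 1/(n + 1) of 1 is kept for the n-th set.\<close>

lemma localized_sequence:
  fixes F :: "real set \<Rightarrow> 'b::chilbert \<Rightarrow> 'b"
  assumes pom: "pom G F" and U: "scurep G U" and cov: "covariant G U F"
    and norm1: "norm1_property G F" and "\<exists>x::'b. x \<noteq> 0"
  obtains \<phi> where "\<And>n. norm (\<phi> n) = 1"
    "(\<lambda>n. measure (pom_measure G F (\<phi> n)) (half_open_neighbourhood n)) \<longlonglongrightarrow> 1"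
proof -
  let ?X = half_open_neighbourhood
  have "\<exists>\<phi>. norm \<phi> = 1 \<and> dist (measure (pom_measure G F \<phi>) (?X n)) 1 < inverse (real (Suc n))" for n
  proof -
    have "F (?X n) \<noteq> (\<lambda>_. 0)"
      using covariant_pom_neighbourhood_nonzero[OF pom U cov] assms(5) by blast
    then obtain \<psi> where \<psi>: "\<And>m. norm (\<psi> m) = 1" "(\<lambda>m. cinner (\<psi> m) (F (?X n) (\<psi> m))) \<longlonglongrightarrow> 1"
      using norm1 half_open_neighbourhood_gsets unfolding norm1_property_def by blast
    have "(\<lambda>m. complex_of_real (measure (pom_measure G F (\<psi> m)) (?X n))) \<longlonglongrightarrow> 1"
      using \<psi>(2) by (simp add: measure_pom_measure[OF pom half_open_neighbourhood_gsets])
    hence "(\<lambda>m. measure (pom_measure G F (\<psi> m)) (?X n)) \<longlonglongrightarrow> 1"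
      using tendsto_Re by fastforce
    hence "\<forall>\<^sub>F m in sequentially. dist (measure (pom_measure G F (\<psi> m)) (?X n)) 1 < inverse (real (Suc n))"
      by (rule tendstoD) simp
    thus ?thesis using \<psi>(1) eventually_happens'[OF sequentially_bot] by blast
  qed
  then obtain \<phi> where \<phi>: "\<And>n. norm (\<phi> n) = 1"
    "\<And>n. dist (measure (pom_measure G F (\<phi> n)) (?X n)) 1 < inverse (real (Suc n))" by metis
  have "(\<lambda>n. measure (pom_measure G F (\<phi> n)) (?X n)) \<longlonglongrightarrow> 1"
  proof (rule metric_LIMSEQ_I)
    fix r :: real assume "0 < r"
    then obtain N where N: "inverse (real (Suc N)) < r" using reals_Archimedean by blast
    have "dist (measure (pom_measure G F (\<phi> n)) (?X n)) 1 < r" if "n \<ge> N" for n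
    proof -
      have "inverse (real (Suc n)) \<le> inverse (real (Suc N))" using that by (intro le_imp_inverse_le) auto
      thus ?thesis using \<phi>(2)[of n] N by linarith
    qed
    thus "\<exists>N. \<forall>n\<ge>N. dist (measure (pom_measure G F (\<phi> n)) (?X n)) 1 < r" by blast
  qed
  thus ?thesis using \<phi>(1) that by blast
qed

theorem mainTheorem4:
  fixes G :: grp
    and US :: "real \<Rightarrow> 'a::chilbert \<Rightarrow> 'a"
    and UR :: "real \<Rightarrow> 'b::chilbert \<Rightarrow> 'b"
    and F :: "real set \<Rightarrow> 'b \<Rightarrow> 'b"
    and t :: "'a \<Rightarrow> 'b \<Rightarrow> 'c::chilbert"
  assumes "separable (UNIV :: 'a set)" and "separable (UNIV :: 'b set)"
    and "\<exists>x::'b. x \<noteq> 0"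
    and "is_tensor t"
    and "scurep G US" and "scurep G UR"
    and "pom G F" and "covariant G UR F" and "norm1_property G F"
  shows "\<exists>\<phi>. (\<forall>n. norm (\<phi> n) = 1) \<and>
           (\<forall>A. bop A \<longrightarrow> (\<forall>\<rho>. density \<rho> \<longrightarrow>
              (\<lambda>n. trace (\<rho> \<circ> Gamma t (\<phi> n) (yen G US F t A))) \<longlonglongrightarrow> trace (\<rho> \<circ> A)))"
proof -
  let ?M = "pom_measure G F" and ?X = half_open_neighbourhood
  note pom = \<open>pom G F\<close> and t = \<open>is_tensor t\<close>
  \<comment> \<open>The sequence is fixed before \<open>A\<close> and \<rho>, so one choice serves
    all of them.\<close>
  obtain \<phi> where \<phi>: "\<And>n. norm (\<phi> n) = 1" "(\<lambda>n. measure (?M (\<phi> n)) (?X n)) \<longlonglongrightarrow> 1"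
    using localized_sequence[OF pom assms(6,8,9,3)] by blast
  have shrink: "\<forall>\<^sub>F n in sequentially. \<forall>g\<in>?X n. \<bar>g\<bar> < d" if "d > 0" for d
  proof -
    have "(\<lambda>n. 2 * pi * inverse (real (Suc n))) \<longlonglongrightarrow> 2 * pi * 0"
      by (intro tendsto_intros LIMSEQ_inverse_real_of_nat)
    hence "\<forall>\<^sub>F n in sequentially. 2 * pi * inverse (real (Suc n)) < d"
      by (rule order_tendstoD) (use that in simp)
    thus ?thesis
      by eventually_elim (auto simp: half_open_neighbourhood_def divide_inverse)
  qed
  have "(\<lambda>n. trace (\<rho> \<circ> Gamma t (\<phi> n) (yen G US F t A))) \<longlonglongrightarrow> trace (\<rho> \<circ> A)"
    if A: "bop A" and \<rho>: "density \<rho>" for A \<rho>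
  proof -
    obtain K where K: "K > 0" "\<And>x. norm (A x) \<le> K * norm x" using bop_bound[OF A] by metis
    obtain v :: "nat \<Rightarrow> 'a" where v: "\<And>x y. (\<lambda>m. cinner x (v m) * cinner (v m) y) sums cinner x (\<rho> y)"
      "summable (\<lambda>m. (norm (v m))\<^sup>2)"
      using density_decomposition[OF assms(1) \<rho>] by blast
    define f where "f m = (\<lambda>g. cinner (US (- g) (v m)) (A (US (- g) (v m))))" for m
    have f_cont: "continuous_on UNIV (f m)" for m
      unfolding f_def by (rule continuous_on_conjugation_form[OF assms(5) A])
    have f_bound: "cmod (f m g) \<le> K * (norm (v m))\<^sup>2" for m g
      using cmod_conjugation_form_le[OF assms(5) K(2), of g "v m" "v m"]
      by (simp add: f_def power2_eq_square mult.assoc)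
    have f_meas: "f m \<in> borel_measurable (?M (\<phi> n))" for m n
      by (intro borel_measurable_pom_measure[OF pom] borel_measurable_continuous_onI f_cont)
    have tot: "measure (?M (\<phi> n)) (space (?M (\<phi> n))) = 1" for n
      by (simp add: space_pom_measure[OF pom] measure_pom_space[OF pom] \<phi>(1))
    note yen = yen_characterization[OF assms(2) t assms(5) pom A]
    have "cinner (v m) (Gamma t (\<phi> n) (yen G US F t A) (v m)) = integral\<^sup>L (?M (\<phi> n)) (f m)" for m n
      by (simp only: Gamma_characterization(2)[OF t assms(1) yen(1)] yen(2) f_def)
    hence "(\<lambda>m. integral\<^sup>L (?M (\<phi> n)) (f m)) sums trace (\<rho> \<circ> Gamma t (\<phi> n) (yen G US F t A))" for n
      using trace_comp_sums[OF v Gamma_characterization(1)[OF t assms(1) yen(1)], of "\<phi> n"] by simp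
    hence tr_n: "trace (\<rho> \<circ> Gamma t (\<phi> n) (yen G US F t A)) = (\<Sum>m. integral\<^sup>L (?M (\<phi> n)) (f m))" for n
      by (rule sums_unique)
    have "f m 0 = cinner (v m) (A (v m))" for m
      by (simp add: f_def unitary_rep_simps(4)[OF assms(5)])
    hence tr: "trace (\<rho> \<circ> A) = (\<Sum>m. f m 0)"
      using trace_comp_sums[OF v A] by (simp add: sums_unique)
    \<comment> \<open>The majorant for Tannery's theorem: uniform in n, and summable over m by the
      trace condition on \<rho>.\<close>
    have bound: "cmod (integral\<^sup>L (?M (\<phi> n)) (f m)) \<le> K * (norm (v m))\<^sup>2" for m n
    proof -
      interpret finite_measure "?M (\<phi> n)" by (rule finite_pom_measure[OF pom])
      have "integrable (?M (\<phi> n)) (f m)"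
        by (rule integrable_const_bound[where B = "K * (norm (v m))\<^sup>2"]) (simp_all only: f_bound f_meas AE_I2)
      hence int: "integrable (?M (\<phi> n)) (\<lambda>g. cmod (f m g))" by (rule integrable_norm)
      have "cmod (integral\<^sup>L (?M (\<phi> n)) (f m)) \<le> (\<integral>g. cmod (f m g) \<partial>?M (\<phi> n))"
        by (rule integral_norm_bound)
      also have "\<dots> \<le> (\<integral>g. K * (norm (v m))\<^sup>2 \<partial>?M (\<phi> n))"
        by (rule integral_mono[OF int integrable_const f_bound])
      also have "\<dots> = K * (norm (v m))\<^sup>2" by (simp add: tot)
      finally show ?thesis .
    qed
    have pointwise: "(\<lambda>n. integral\<^sup>L (?M (\<phi> n)) (f m)) \<longlonglongrightarrow> f m 0" for m
      by (rule integral_concentrating_tendsto[where X = ?X])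
        (auto intro: finite_pom_measure[OF pom] tot f_meas f_bound f_cont \<phi>(2) shrink
          simp: sets_pom_measure[OF pom] half_open_neighbourhood_gsets)
    have "(\<lambda>n. \<Sum>m. integral\<^sup>L (?M (\<phi> n)) (f m)) \<longlonglongrightarrow> (\<Sum>m. f m 0)"
    proof -
      have "\<forall>\<^sub>F (m, n) in at_top \<times>\<^sub>F sequentially. cmod (integral\<^sup>L (?M (\<phi> n)) (f m)) \<le> K * (norm (v m))\<^sup>2"
        using bound by (intro always_eventually) auto
      from tannerys_theorem[OF pointwise this summable_mult[OF v(2)] sequentially_bot] show ?thesis by blast
    qed
    thus ?thesis by (simp only: tr_n tr)
  qed
  thus ?thesis using \<phi>(1) by blast
qed

end
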